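(* Suppose that: (i) $|f_j(u)-f_j(v)|\le L_j^f|u-v|$ and $|g_j(u)-g_j(v)|\le L_j^g|u-v|$ for all $u,v\in\mathbb R$, $j=1,\dots,m$, with constants $L_j^f,L_j^g>0$; (ii) $|I_{ik}(u)-I_{ik}(v)|\le \ell|u-v|$ for all $u,v\in\mathbb R$, $i=1,\dots,m$, $k\in\mathbb N$, with a constant $\ell>0$; (iii) $\big[(k_1+2k_2)\overline\theta+\ell p\big](1+\ell)^p e^{k_1\overline\theta}<1$; (iv) there are a real number $\omega>0$ and positive integers $q,p_1$ such that $\tau_{k+q}=\tau_k+\omega$, $\theta_{k+p_1}=\theta_k+\omega$ and $I_{i,k+q}=I_{ik}$ for all $k\in\mathbb N$ and $i=1,\dots,m$, and $[0,\omega]$ contains exactly $q$ points of the sequence $\tau$; (v) $\mathcal R\big(\omega(\mu+\lambda k_2)+\ell q\big)<1$, where $\mathcal R=\dfrac{1}{1-e^{-\gamma\omega}}$. Then the system $$x_i'(t)=-a_ix_i(t)+\sum_{j=1}^m b_{ij}f_j(x_j(t))+\sum_{j=1}^m c_{ij}g_j(x_j(\beta(t)))+d_i,\quad t\ne\tau_k,$$ $$\Delta x_i|_{t=\tau_k}=I_{ik}(x_i(\tau_k^-)),\quad i=1,\dots,m,\ k\in\mathbb N,$$ has a unique $\omega$-periodic solution.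
   Context: $\mathbb N=\{0,1,2,\dots\}$, $\mathbb R^+=[0,\infty)$, $\|u\|=\sum_{i=1}^m|u_i|$ on $\mathbb R^m$. The sequences $\theta=\{\theta_k\}_{k\in\mathbb N}$ (with $\theta_0=0$) and $\tau=\{\tau_k\}_{k\in\mathbb N}$ are real, strictly increasing, tend to $\infty$, and are disjoint: $\tau\cap\theta=\emptyset$. There are positive numbers $\overline\theta,\underline\tau$ with $\theta_{k+1}-\theta_k\le\overline\theta$ and $\underline\tau\le\tau_{k+1}-\tau_k$ for all $k\in\mathbb N$. The integer $p$ is the maximum over $k\in\mathbb N$ of the number of points of $\tau$ in $(\theta_k,\theta_{k+1})$, assumed finite. The function $\beta:\mathbb R^+\to\mathbb R^+$ is defined by $\beta(t)=\theta_k$ for $\theta_k\le t<\theta_{k+1}$. The numbers $a_i>0$ and $b_{ij},c_{ij},d_i\in\mathbb R$ ($i,j=1,\dots,m$) are constants; $f_j,g_j,I_{ik}:\mathbb R\to\mathbb R$. Put $$k_1=\max_{1\le i\le m}\Big(a_i+L_i^f\sum_{j=1}^m|b_{ji}|\Big),\quad k_2=\max_{1\le i\le m}\Big(L_i^g\sum_{j=1}^m|c_{ji}|\Big),\quad \mu=\max_{1\le i\le m}\Big(L_i^f\sum_{j=1}^m|b_{ji}|\Big),\quad \gamma=\min_{1\le i\le m}a_i,$$ $$\lambda=\Big(1-\big(k_2\overline\theta+(k_1\overline\theta+\ell p)(1+k_2\overline\theta)(1+\ell)^p e^{k_1\overline\theta}\big)\Big)^{-1}.$$ $\Delta x_i|_{t=\tau_k}=x_i(\tau_k)-x_i(\tau_k^-)$,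 where $x_i(\tau_k^-)$ is the left limit. A solution is a right-continuous function $x:\mathbb R^+\to\mathbb R^m$, continuous except possibly at points of $\tau$ where it has discontinuities of the first kind, whose derivative $x'$ is right-continuous and continuous except possibly at points of $\tau\cup\theta$ where it has discontinuities of the first kind (the derivative at such points being the right derivative), and which satisfies the differential equation and the jump conditions. It is $\omega$-periodic if $x(t+\omega)=x(t)$ for all $t\ge0$. *)

theory Defs
  imports "HOL-Analysis.Analysis"
begin

definition impulse_count :: "(nat \<Rightarrow> real) \<Rightarrow> (nat \<Rightarrow> real) \<Rightarrow> nat \<Rightarrow> nat" where
  "impulse_count \<theta> \<tau> k = card (range \<tau> \<inter> {\<theta> k<..<\<theta> (Suc k)})"

text \<open>
  For a strictly increasing \<open>\<theta>\<close> with \<open>\<theta> 0 = 0\<close> and \<open>\<theta> \<longlonglongrightarrow> \<infinity>\<close>, the index \<open>k\<close> below exists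
  uniquely for every \<open>t \<ge> 0\<close>; the value at negative \<open>t\<close> is irrelevant.
\<close>
definition pc_arg :: "(nat \<Rightarrow> real) \<Rightarrow> real \<Rightarrow> real" where
  "pc_arg \<theta> t = \<theta> (THE k. \<theta> k \<le> t \<and> t < \<theta> (Suc k))"

definition left_lim :: "(real \<Rightarrow> 'a::t2_space) \<Rightarrow> real \<Rightarrow> 'a" where
  "left_lim x t = Lim (at_left t) x"

text \<open>
  Right-continuous on \<open>[0,\<infinity>)\<close> and continuous except possibly at points of \<open>S\<close>, where the
  discontinuities are of the first kind. The right limits exist by right-continuity, so only
  the left limits have to be demanded.
\<close>
definition right_cont_except :: "real set \<Rightarrow> (real \<Rightarrow> 'a::t2_space) \<Rightarrow> bool" where
  "right_cont_except S x \<longleftrightarrow>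
     (\<forall>t\<ge>0. continuous (at_right t) x) \<and>
     (\<forall>t>0. t \<notin> S \<longrightarrow> isCont x t) \<and>
     (\<forall>t>0. t \<in> S \<longrightarrow> (\<exists>l. (x \<longlongrightarrow> l) (at_left t)))"

text \<open>
  A function \<open>[0,\<infinity>) \<rightarrow> \<real>\<^sup>m\<close> is represented by a total function that is \<open>undefined\<close> at negative
  times, so that equality of solutions is equality on \<open>[0,\<infinity>)\<close>. The derivative \<open>x'\<close> is the right
  derivative at \<open>0\<close> and at the points of \<open>\<tau> \<union> \<theta>\<close>, and the two-sided derivative elsewhere.
  Nothing prevents finitely many \<open>\<tau> k\<close> from being negative; these lie outside the domain and
  carry no jump condition.
\<close>
definition is_solution ::
  "(nat \<Rightarrow> real) \<Rightarrow> (nat \<Rightarrow> real) \<Rightarrow> ('m \<Rightarrow> real) \<Rightarrow> ('m \<Rightarrow> 'm \<Rightarrow> real) \<Rightarrow> ('m \<Rightarrow> 'm \<Rightarrow> real) \<Rightarrow> ('m \<Rightarrow> real)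
    \<Rightarrow> ('m \<Rightarrow> real \<Rightarrow> real) \<Rightarrow> ('m \<Rightarrow> real \<Rightarrow> real) \<Rightarrow> ('m \<Rightarrow> nat \<Rightarrow> real \<Rightarrow> real) \<Rightarrow> (real \<Rightarrow> real ^ 'm::finite) \<Rightarrow> bool"
where
  "is_solution \<theta> \<tau> a b c d f g I x \<longleftrightarrow>
     x \<in> extensional {0..} \<and>
     right_cont_except (range \<tau>) x \<and>
     (\<exists>x'. right_cont_except (range \<tau> \<union> range \<theta>) x' \<and>
        (\<forall>t\<ge>0. (x has_vector_derivative x' t) (at_right t)) \<and>
        (\<forall>t>0. t \<notin> range \<tau> \<union> range \<theta> \<longrightarrow> (x has_vector_derivative x' t) (at t)) \<and>
        (\<forall>t\<ge>0. t \<notin> range \<tau> \<longrightarrow> (\<forall>i. x' t $ i =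
            - a i * x t $ i + (\<Sum>j\<in>UNIV. b i j * f j (x t $ j))
            + (\<Sum>j\<in>UNIV. c i j * g j (x (pc_arg \<theta> t) $ j)) + d i))) \<and>
     (\<forall>k i. \<tau> k > 0 \<longrightarrow>
        x (\<tau> k) $ i - left_lim x (\<tau> k) $ i = I i k (left_lim x (\<tau> k) $ i))"

definition is_periodic :: "real \<Rightarrow> (real \<Rightarrow> 'a) \<Rightarrow> bool" where
  "is_periodic \<omega> x \<longleftrightarrow> (\<forall>t\<ge>0. x (t + \<omega>) = x t)"

end

theory Submission
  imports Defs
begin

text \<open>
  A periodic solution is the same thing as a fixed point of a contraction. Freeze the
  nonlinear terms: once a forcing \<open>h\<close> and impulse sizes \<open>w\<close> are known and \<open>\<omega>\<close>-periodic, each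
  component solves a scalar equation \<open>u' = - a u + h\<close> with jumps \<open>w\<^sub>k\<close>, and since \<open>a > 0\<close> this
  has exactly one \<open>\<omega>\<close>-periodic solution, which variation of constants writes down explicitly
  (\<open>response\<close>). Inserting for \<open>h\<close> and \<open>w\<close> the values computed from a function \<open>y\<close> gives an
  operator whose fixed points are the periodic solutions.

  The kernel of the periodic response is bounded by \<open>1 / (1 - exp (- a \<omega>)) \<le> R\<close>
  (\<open>response_bound\<close>). For the norm \<open>sup\<^sub>t \<parallel>y t\<parallel>\<close>, with \<open>\<parallel>_\<parallel>\<close> the sum of the absolute values
  of the components, the forcing is Lipschitz with constant \<open>\<mu> + k2\<close>: the delayed value
  \<open>y (\<beta> t)\<close> is controlled by the same supremum as \<open>y t\<close>. Over one period this contributes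
  \<open>\<omega> (\<mu> + k2)\<close>, and the \<open>q\<close> impulses contribute \<open>l q\<close>, so the operator has the Lipschitz
  constant \<open>R (\<omega> (\<mu> + k2) + l q)\<close> (\<open>operator_contraction\<close>). The smallness condition forces
  \<open>1 \<le> \<lambda>\<close> (\<open>memory_factor_ge_1\<close>), so this number is at most \<open>R (\<omega> (\<mu> + \<lambda> k2) + l q) < 1\<close>.

  The unknown \<open>y\<close> of the operator is the left-continuous version of the solution \<open>x\<close>. Then the
  left limit that determines an impulse is a value of \<open>y\<close>, which makes sense for every
  function, and the operator acts on all bounded Borel periodic functions, a class that is
  closed under uniform convergence. Switching between \<open>x\<close> and \<open>y\<close> changes the
  forcing only at impulse times, a null set, because \<open>\<beta>\<close> takes its values in the switching
  times, which are disjoint from the impulse times. The continuity and differentiability that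
  a solution must have are recovered for a fixed point from the integral formula, since near
  every time, on each side, it is an integral curve without jumps
  (\<open>solution_of_local_flow\<close>). Conversely every solution satisfies the integral formula by the
  fundamental theorem of calculus (\<open>solution_variation_of_constants\<close>), and periodicity fixes
  its initial value.
\<close>

section \<open>Sums over impulse times\<close>

locale impulse_times =
  fixes \<tau> :: "nat \<Rightarrow> real"
  assumes increasing: "strict_mono \<tau>" and unbounded: "filterlim \<tau> at_top sequentially"
begin

lemma finite_up_to: "finite {k. \<tau> k \<le> T}"
proof -
  have "eventually (\<lambda>k. \<tau> k > T) sequentially"
    using unbounded by (simp add: filterlim_at_top_dense)
  then obtain N where "\<forall>k\<ge>N. \<tau> k > T" by (auto simp: eventually_sequentially)
  then have "{k. \<tau> k \<le> T} \<subseteq> {..<N}" by (force simp: not_le[symmetric])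
  then show ?thesis by (rule finite_subset) simp
qed

lemma finite_between [simp]: "finite {k. 0 < \<tau> k \<and> \<tau> k < T}"
  by (rule finite_subset[OF _ finite_up_to[of T]]) auto

lemma finite_hits [simp]: "finite {k. 0 < \<tau> k \<and> \<tau> k = t}"
  by (rule finite_subset[OF _ finite_up_to[of t]]) auto

lemma inj_times: "\<tau> j = \<tau> k \<longleftrightarrow> j = k"
  using increasing by (simp add: strict_mono_eq)

lemma isolated:
  obtains e where "e > 0" "\<And>k. \<tau> k \<noteq> t \<Longrightarrow> \<bar>\<tau> k - t\<bar> < e \<Longrightarrow> False"
proof -
  have "finite (\<tau> ` {k. \<tau> k \<le> t + 1})" by (simp add: finite_up_to)
  from finite_set_avoid[OF this, of t]
  obtain d where d: "d > 0" "\<And>k. \<tau> k \<le> t + 1 \<Longrightarrow> \<tau> k \<noteq> t \<Longrightarrow> d \<le> dist t (\<tau> k)" by auto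
  show thesis
  proof (rule that[of "min d 1"])
    fix k assume "\<tau> k \<noteq> t" "\<bar>\<tau> k - t\<bar> < min d 1"
    then show False using d(2)[of k] by (auto simp: dist_real_def abs_if split: if_splits)
  qed (use d in auto)
qed

text \<open>
  The strict inequality \<open>\<tau> k < t\<close> makes this step function left-continuous; \<open>jump_at\<close> is what
  must be added to obtain its right-continuous version. Only positive impulse times count.
\<close>
definition jump_sum :: "(nat \<Rightarrow> real) \<Rightarrow> real \<Rightarrow> real" where
  "jump_sum w t = (\<Sum>k | 0 < \<tau> k \<and> \<tau> k < t. w k)"

definition jump_at :: "(nat \<Rightarrow> real) \<Rightarrow> real \<Rightarrow> real" where
  "jump_at w t = (\<Sum>k | 0 < \<tau> k \<and> \<tau> k = t. w k)"

lemma jump_at_impulse: "\<tau> k > 0 \<Longrightarrow> jump_at w (\<tau> k) = w k"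
proof -
  assume "\<tau> k > 0"
  then have "{j. 0 < \<tau> j \<and> \<tau> j = \<tau> k} = {k}" using inj_times by auto
  then show ?thesis by (simp add: jump_at_def)
qed

lemma jump_at_other: "t \<notin> range \<tau> \<Longrightarrow> jump_at w t = 0"
  unfolding jump_at_def by (rule sum.neutral) auto

text \<open>
  The radius does not depend on the weights, so that finitely many components can share it.
\<close>
lemma jump_sum_locally_constant:
  obtains e where "e > 0"
    "\<And>s w. t < s \<Longrightarrow> s < t + e \<Longrightarrow> s \<notin> range \<tau> \<and> jump_sum w s = jump_sum w t + jump_at w t"
    "\<And>s w. t - e < s \<Longrightarrow> s < t \<Longrightarrow> s \<notin> range \<tau> \<and> jump_sum w s = jump_sum w t"
proof -
  from isolated obtain e where e: "e > 0" "\<And>k. \<tau> k \<noteq> t \<Longrightarrow> \<bar>\<tau> k - t\<bar> < e \<Longrightarrow> False" by blast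
  show thesis
  proof (rule that[of e])
    fix s w assume s: "t < s" "s < t + e"
    have "{k. 0 < \<tau> k \<and> \<tau> k < s} = {k. 0 < \<tau> k \<and> \<tau> k < t} \<union> {k. 0 < \<tau> k \<and> \<tau> k = t}"
      using e(2) s by (auto simp: abs_if) (smt (verit))+
    then have "jump_sum w s = jump_sum w t + jump_at w t"
      unfolding jump_sum_def jump_at_def by (auto intro!: sum.union_disjoint)
    then show "s \<notin> range \<tau> \<and> jump_sum w s = jump_sum w t + jump_at w t"
      using e(2) s by fastforce
  next
    fix s w assume s: "t - e < s" "s < t"
    have "{k. 0 < \<tau> k \<and> \<tau> k < s} = {k. 0 < \<tau> k \<and> \<tau> k < t}"
      using e(2) s by (auto simp: abs_if) (smt (verit))+
    then show "s \<notin> range \<tau> \<and> jump_sum w s = jump_sum w t"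
      unfolding jump_sum_def using e(2) s by fastforce
  qed (use e in auto)
qed

text \<open>
  For nonnegative weights the function is monotone, hence Borel; the general case is a
  difference of two such functions.
\<close>
lemma jump_sum_measurable: "jump_sum w \<in> borel_measurable borel"
proof -
  have mono: "mono (jump_sum v)" if "\<And>k. v k \<ge> 0" for v
    unfolding jump_sum_def by (intro monoI sum_mono2) (use that in auto)
  have "jump_sum w = (\<lambda>t. jump_sum (\<lambda>k. max (w k) 0) t - jump_sum (\<lambda>k. max (- w k) 0) t)"
    unfolding jump_sum_def by (auto simp: fun_eq_iff sum_subtractf[symmetric] max_def intro!: sum.cong)
  moreover have "\<dots> \<in> borel_measurable borel"
    by (intro borel_measurable_diff borel_measurable_mono mono) auto
  ultimately show ?thesis by simp
qed

lemma negligible_times: "negligible (range \<tau>)"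
proof -
  have "negligible (\<Union>((\<lambda>x. {x}) ` range \<tau>))" by (rule negligible_countable_Union) auto
  then show ?thesis by simp
qed

end

section \<open>Scalar linear equations with integrable forcing\<close>

definition loc_integrable :: "(real \<Rightarrow> real) \<Rightarrow> bool" where
  "loc_integrable h \<longleftrightarrow> (\<forall>T. h integrable_on {0..T})"

lemma loc_integrable_sub: "loc_integrable h \<Longrightarrow> 0 \<le> s \<Longrightarrow> h integrable_on {s..t}"
  unfolding loc_integrable_def by (meson atLeastatMost_subset_iff integrable_subinterval_real order_refl)

lemma loc_integrable_split:
  assumes "loc_integrable h" "0 \<le> s" "s \<le> t"
  shows "integral {0..t} h = integral {0..s} h + integral {s..t} h"
  using assms Henstock_Kurzweil_Integration.integral_combine[of 0 s t h] by (simp add: loc_integrable_def)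

text \<open>The solution of \<open>u' = - a u + h\<close> with \<open>u 0 = K\<close>, for locally integrable \<open>h\<close>.\<close>
definition flow :: "real \<Rightarrow> (real \<Rightarrow> real) \<Rightarrow> real \<Rightarrow> real \<Rightarrow> real" where
  "flow a h K t = exp (- a * t) * (K + integral {0..t} (\<lambda>s. exp (a * s) * h s))"

lemma flow_continuous:
  assumes "loc_integrable (\<lambda>s. exp (a * s) * h s)"
  shows "continuous_on {0..} (flow a h K)"
proof -
  let ?k = "\<lambda>s. exp (a * s) * h s"
  have "continuous_on {0..} (\<lambda>t. integral {0..t} ?k)"
  proof (clarsimp simp: continuous_on_eq_continuous_within)
    fix t :: real assume t: "0 \<le> t"
    have "continuous (at t within {0..t+1}) (\<lambda>t. integral {0..t} ?k)"
      using indefinite_integral_continuous_1[of ?k 0 "t+1"] assms t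
      by (auto simp: loc_integrable_def continuous_on_eq_continuous_within)
    moreover have "at t within {0..} = at t within {0..t+1}"
      by (rule at_within_nhd[of _ "{t-1<..<t+1}"]) auto
    ultimately show "continuous (at t within {0..}) (\<lambda>t. integral {0..t} ?k)" by simp
  qed
  then show ?thesis unfolding flow_def by (intro continuous_intros)
qed

text \<open>
  Stating this on an interval \<open>{c..e}\<close> that need not start at \<open>0\<close> covers at once the right
  derivative (\<open>c = t\<close>) and the two-sided one (\<open>c < t < e\<close>).
\<close>
lemma flow_derivative_within:
  assumes int: "loc_integrable (\<lambda>s. exp (a * s) * h s)"
    and "0 \<le> c" "c \<le> t" "t \<le> e" and cont: "continuous (at t within {c..e}) h"
  shows "(flow a h K has_vector_derivative - a * flow a h K t + h t) (at t within {c..e})"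
proof -
  let ?k = "\<lambda>s. exp (a * s) * h s"
  have "((\<lambda>u. integral {c..u} ?k) has_vector_derivative ?k t) (at t within ({c..e} - {}))"
  proof (rule integral_has_vector_derivative_continuous_at)
    show "?k integrable_on {c..e}" using int assms by (auto intro: loc_integrable_sub)
    show "continuous (at t within ({c..e} - {})) ?k" using cont by (auto intro!: continuous_intros)
  qed (use assms in auto)
  then have "((\<lambda>u. integral {c..u} ?k) has_real_derivative ?k t) (at t within {c..e})"
    by (simp add: has_real_derivative_iff_has_vector_derivative)
  then have "((\<lambda>u. exp (- a * u) * (K + (integral {0..c} ?k + integral {c..u} ?k)))
      has_real_derivative (- a) * exp (- a * t) * (K + (integral {0..c} ?k + integral {c..t} ?k))
        + exp (- a * t) * ?k t) (at t within {c..e})"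
    by (auto intro!: derivative_eq_intros)
  then have "(flow a h K has_real_derivative (- a) * exp (- a * t) * (K + (integral {0..c} ?k + integral {c..t} ?k))
        + exp (- a * t) * ?k t) (at t within {c..e})"
  proof (rule has_field_derivative_transform_within[OF _ zero_less_one])
    fix u assume "u \<in> {c..e}"
    then show "exp (- a * u) * (K + (integral {0..c} ?k + integral {c..u} ?k)) = flow a h K u"
      unfolding flow_def using loc_integrable_split[OF int, of c u] assms by auto
  qed (use assms in auto)
  moreover have "(- a) * exp (- a * t) * (K + (integral {0..c} ?k + integral {c..t} ?k))
        + exp (- a * t) * ?k t = - a * flow a h K t + h t"
    unfolding flow_def using loc_integrable_split[OF int, of c t] assms
    by (simp add: mult.assoc[symmetric] flip: exp_add)
  ultimately show ?thesis by (simp add: has_real_derivative_iff_has_vector_derivative)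
qed

lemma flow_right_derivative:
  assumes "loc_integrable (\<lambda>s. exp (a * s) * h s)" "0 \<le> t" "continuous (at_right t) h"
  shows "(flow a h K has_vector_derivative - a * flow a h K t + h t) (at_right t)"
  using flow_derivative_within[OF assms(1), of t t "t+1"] assms by (simp add: at_within_Icc_at_right)

lemma flow_derivative:
  assumes "loc_integrable (\<lambda>s. exp (a * s) * h s)" "0 < t" "isCont h t"
  shows "(flow a h K has_vector_derivative - a * flow a h K t + h t) (at t)"
  using flow_derivative_within[OF assms(1), of 0 t "t+1"] assms by (simp add: at_within_Icc_at)

lemma flow_cong:
  assumes "negligible N" "\<And>s. s \<ge> 0 \<Longrightarrow> s \<notin> N \<Longrightarrow> h s = h' s"
  shows "flow a h K t = flow a h' K t"
proof -
  have "integral {0..t} (\<lambda>s. exp (a * s) * h s) = integral {0..t} (\<lambda>s. exp (a * s) * h' s)"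
    by (rule integral_spike[OF assms(1)]) (use assms(2) in auto)
  then show ?thesis by (simp add: flow_def)
qed

text \<open>
  Measurability is demanded on the half-line only, because the piecewise constant argument has
  no meaningful values at negative times.
\<close>
lemma measurable_bounded_loc_integrable:
  assumes "h \<in> borel_measurable (restrict_space borel {0..})" "\<And>t. 0 \<le> t \<Longrightarrow> \<bar>h t\<bar> \<le> B"
  shows "loc_integrable h"
  unfolding loc_integrable_def
proof
  fix T :: real
  have "h \<in> borel_measurable (restrict_space borel {0..T})"
    by (rule measurable_restrict_mono[OF assms(1)]) auto
  then have "(\<lambda>t. indicator {0..T} t *\<^sub>R h t) \<in> borel_measurable lborel"
    by (subst (asm) borel_measurable_restrict_space_iff) auto
  then have "(\<lambda>t. indicator {0..T} t *\<^sub>R h t) \<in> borel_measurable lebesgue"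
    by (rule measurable_completion)
  then have "h \<in> borel_measurable (lebesgue_on {0..T})"
    by (subst borel_measurable_restrict_space_iff) auto
  then show "h integrable_on {0..T}"
    by (rule measurable_bounded_by_integrable_imp_integrable[where g = "\<lambda>_. B"]) (use assms in auto)
qed

lemma exp_weighted_loc_integrable:
  assumes "h \<in> borel_measurable (restrict_space borel {0..})" "\<And>t. 0 \<le> t \<Longrightarrow> \<bar>h t\<bar> \<le> B"
  shows "loc_integrable (\<lambda>s. exp (a * s) * h s)"
proof -
  have "(\<lambda>s. exp (a * s) * h s) integrable_on {0..T}" for T
  proof -
    have "h \<in> borel_measurable (lebesgue_on {0..T})"
      using measurable_bounded_loc_integrable[OF assms]
      by (simp add: loc_integrable_def integrable_imp_measurable)
    moreover have "(\<lambda>s. exp (a * s)) \<in> borel_measurable (lebesgue_on {0..T})"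
      by (intro continuous_imp_measurable_on_sets_lebesgue continuous_intros) auto
    ultimately have "(\<lambda>s. exp (a * s) * h s) \<in> borel_measurable (lebesgue_on {0..T})"
      by (rule borel_measurable_times[rotated])
    then show ?thesis
    proof (rule measurable_bounded_by_integrable_imp_integrable[where g = "\<lambda>_. exp (\<bar>a\<bar> * \<bar>T\<bar>) * B"])
      fix s assume s: "s \<in> {0..T}"
      have "a * s \<le> \<bar>a\<bar> * \<bar>T\<bar>" using s by (intro mult_mono) auto
      then show "norm (exp (a * s) * h s) \<le> exp (\<bar>a\<bar> * \<bar>T\<bar>) * B"
        using assms(2)[of s] s by (auto simp: abs_mult intro!: mult_mono)
    qed (auto intro: integrable_on_const)
  qed
  then show ?thesis by (simp add: loc_integrable_def)
qed

section \<open>Periodic response to periodic forcing and impulses\<close>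

text \<open>
  The pattern of positive impulse times repeats with period \<open>\<omega>\<close>, with \<open>q\<close> impulses per period.
  Impulse times may be negative, so \<open>\<tau> 0\<close> need not be the first relevant one.
\<close>
locale periodic_impulses = impulse_times +
  fixes \<omega> :: real and q :: nat
  assumes period_pos: "\<omega> > 0"
    and times_shift: "\<tau> (k + q) = \<tau> k + \<omega>"
    and times_count: "card (range \<tau> \<inter> {0..\<omega>}) = q"
    and no_impulse_0: "0 \<notin> range \<tau>" and no_impulse_period: "\<omega> \<notin> range \<tau>"
begin

lemma window_count: "card {k. 0 < \<tau> k \<and> \<tau> k < \<omega>} = q"
proof -
  have "range \<tau> \<inter> {0..\<omega>} = \<tau> ` {k. 0 < \<tau> k \<and> \<tau> k < \<omega>}"
    using no_impulse_0 no_impulse_period by (force simp: less_le)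
  moreover have "inj_on \<tau> {k. 0 < \<tau> k \<and> \<tau> k < \<omega>}"
    by (auto simp: inj_on_def inj_times)
  ultimately show ?thesis using times_count by (simp add: card_image)
qed

text \<open>
  An impulse time beyond \<open>\<omega>\<close> has all \<open>q\<close> impulse times of the first period before it, so its
  index is at least \<open>q\<close> and it is a translate of an earlier positive impulse time.
\<close>
lemma past_window:
  assumes "\<tau> k \<ge> \<omega>"
  shows "q \<le> k" "0 < \<tau> (k - q)" "\<tau> (k - q) = \<tau> k - \<omega>"
proof -
  have "{j. 0 < \<tau> j \<and> \<tau> j < \<omega>} \<subseteq> {..<k}"
  proof clarify
    fix j assume "\<tau> j < \<omega>"
    with assms have "\<tau> j < \<tau> k" by simp
    then show "j < k" using increasing by (simp add: strict_mono_less)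
  qed
  from card_mono[OF _ this] show "q \<le> k" by (simp add: window_count)
  then have eq: "\<tau> k = \<tau> (k - q) + \<omega>" using times_shift[of "k - q"] by simp
  then show "\<tau> (k - q) = \<tau> k - \<omega>" by simp
  have "\<tau> k \<noteq> \<omega>" using no_impulse_period by auto
  with eq assms show "0 < \<tau> (k - q)" by linarith
qed

text \<open>
  The factor \<open>c\<close> is there for weights of the form \<open>exp (a * \<tau> k) * w k\<close>, which are multiplied
  by \<open>exp (a * \<omega>)\<close> under a shift by one period.
\<close>
lemma jump_sum_shift:
  assumes "\<And>k. 0 < \<tau> k \<Longrightarrow> w (k + q) = c * w k" "0 \<le> t"
  shows "jump_sum w (t + \<omega>) = jump_sum w \<omega> + c * jump_sum w t"
proof -
  let ?A = "{k. 0 < \<tau> k \<and> \<tau> k < \<omega>}" and ?B = "{k. 0 < \<tau> k \<and> \<tau> k < t}"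
  have "{k. 0 < \<tau> k \<and> \<tau> k < t + \<omega>} = ?A \<union> (\<lambda>k. k + q) ` ?B"
  proof (intro equalityI subsetI)
    fix k assume k: "k \<in> {k. 0 < \<tau> k \<and> \<tau> k < t + \<omega>}"
    show "k \<in> ?A \<union> (\<lambda>k. k + q) ` ?B"
    proof (cases "\<tau> k < \<omega>")
      case False
      then have "k = (k - q) + q" "k - q \<in> ?B" using past_window[of k] k by auto
      then show ?thesis by blast
    qed (use k in auto)
  next
    fix k assume "k \<in> ?A \<union> (\<lambda>k. k + q) ` ?B"
    then show "k \<in> {k. 0 < \<tau> k \<and> \<tau> k < t + \<omega>}"
      using assms(2) period_pos times_shift by auto
  qed
  moreover have "?A \<inter> (\<lambda>k. k + q) ` ?B = {}" using times_shift by auto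
  ultimately have "jump_sum w (t + \<omega>) = jump_sum w \<omega> + sum w ((\<lambda>k. k + q) ` ?B)"
    unfolding jump_sum_def by (simp add: sum.union_disjoint)
  also have "sum w ((\<lambda>k. k + q) ` ?B) = c * jump_sum w t"
    unfolding jump_sum_def by (subst sum.reindex) (auto simp: assms(1) sum_distrib_left)
  finally show ?thesis .
qed

definition weighted :: "real \<Rightarrow> (nat \<Rightarrow> real) \<Rightarrow> nat \<Rightarrow> real" where
  "weighted a w k = exp (a * \<tau> k) * w k"

definition accum :: "real \<Rightarrow> (real \<Rightarrow> real) \<Rightarrow> (nat \<Rightarrow> real) \<Rightarrow> real \<Rightarrow> real" where
  "accum a h w t = integral {0..t} (\<lambda>s. exp (a * s) * h s) + jump_sum (weighted a w) t"

text \<open>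
  The periodic solution of \<open>u' = - a u + h\<close> with jumps \<open>w k\<close> at \<open>\<tau> k\<close>, in its left-continuous
  version. The first summand is the initial value, obtained by solving \<open>u \<omega> = u 0\<close>.
\<close>
definition response :: "real \<Rightarrow> (real \<Rightarrow> real) \<Rightarrow> (nat \<Rightarrow> real) \<Rightarrow> real \<Rightarrow> real" where
  "response a h w t =
     flow a h (exp (- a * \<omega>) / (1 - exp (- a * \<omega>)) * accum a h w \<omega> + jump_sum (weighted a w) t) t"

lemma response_accum:
  "response a h w t =
     exp (- a * t) * (exp (- a * \<omega>) / (1 - exp (- a * \<omega>)) * accum a h w \<omega> + accum a h w t)"
  by (simp add: response_def flow_def accum_def)

lemma accum_shift:
  assumes int: "loc_integrable (\<lambda>s. exp (a * s) * h s)"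
    and h: "\<And>s. 0 \<le> s \<Longrightarrow> h (s + \<omega>) = h s" and w: "\<And>k. 0 < \<tau> k \<Longrightarrow> w (k + q) = w k" and "0 \<le> t"
  shows "accum a h w (t + \<omega>) = accum a h w \<omega> + exp (a * \<omega>) * accum a h w t"
proof -
  let ?k = "\<lambda>s. exp (a * s) * h s"
  have "jump_sum (weighted a w) (t + \<omega>) = jump_sum (weighted a w) \<omega> + exp (a * \<omega>) * jump_sum (weighted a w) t"
    by (rule jump_sum_shift) (auto simp: weighted_def times_shift w \<open>0 \<le> t\<close> distrib_left exp_add)
  moreover have "integral {0..t + \<omega>} ?k = integral {0..\<omega>} ?k + exp (a * \<omega>) * integral {0..t} ?k"
  proof -
    have "integral {0..t + \<omega>} ?k = integral {0..\<omega>} ?k + integral {\<omega>..t + \<omega>} ?k"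
      using loc_integrable_split[OF int, of \<omega> "t + \<omega>"] period_pos \<open>0 \<le> t\<close> by simp
    moreover have "integral {\<omega>..t + \<omega>} ?k = integral {0..t} (\<lambda>s. ?k (s + \<omega>))"
    proof -
      have "(?k has_integral integral {\<omega>..t+\<omega>} ?k) (cbox \<omega> (t + \<omega>))"
        using loc_integrable_sub[OF int, of \<omega> "t + \<omega>"] period_pos by (auto simp: has_integral_integral)
      from has_integral_affinity'[OF this, of 1 \<omega>]
      show ?thesis by (simp add: integral_unique)
    qed
    moreover have "integral {0..t} (\<lambda>s. ?k (s + \<omega>)) = integral {0..t} (\<lambda>s. exp (a * \<omega>) * ?k s)"
      by (rule integral_cong) (simp add: h distrib_left exp_add)
    ultimately show ?thesis by simp
  qed
  ultimately show ?thesis unfolding accum_def by (simp add: algebra_simps)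
qed

lemma decay_less_1: "0 < a \<Longrightarrow> exp (- a * \<omega>) < 1"
  using period_pos by simp

lemma response_periodic:
  assumes "0 < a" "loc_integrable (\<lambda>s. exp (a * s) * h s)"
    and "\<And>s. 0 \<le> s \<Longrightarrow> h (s + \<omega>) = h s" "\<And>k. 0 < \<tau> k \<Longrightarrow> w (k + q) = w k" "0 \<le> t"
  shows "response a h w (t + \<omega>) = response a h w t"
proof -
  define E where "E = exp (- a * \<omega>)"
  have E: "E < 1" "E > 0" "exp (a * \<omega>) = 1 / E" "exp (- a * (t + \<omega>)) = exp (- a * t) * E"
    using decay_less_1[OF assms(1)] by (simp_all add: E_def exp_minus field_simps flip: exp_add)
  have shift: "accum a h w (t + \<omega>) = accum a h w \<omega> + exp (a * \<omega>) * accum a h w t"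
    by (rule accum_shift) (use assms in auto)
  have eq: "E * (E / (1 - E) * x + (x + 1 / E * y)) = E / (1 - E) * x + y" for x y
    using E(1,2) by (simp add: field_simps)
  show ?thesis
    unfolding response_accum shift E(3,4) E_def[symmetric]
    by (simp only: mult.assoc eq)
qed

text \<open>This is the linear equation \<open>u \<omega> = u 0\<close> for the initial value \<open>z\<close>, solved for \<open>z\<close>.\<close>
lemma response_unique:
  assumes "0 < a" "flow a h (z + jump_sum (weighted a w) \<omega>) \<omega> = z"
  shows "z = exp (- a * \<omega>) / (1 - exp (- a * \<omega>)) * accum a h w \<omega>"
proof -
  define E where "E = exp (- a * \<omega>)"
  have "z = E * (z + accum a h w \<omega>)"
    using assms(2) by (simp add: E_def flow_def accum_def add.assoc add.commute)
  moreover have "E < 1" using decay_less_1[OF assms(1)] by (simp add: E_def)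
  ultimately show ?thesis unfolding E_def[symmetric] by (simp add: field_simps)
qed

lemma response_diff:
  assumes "loc_integrable (\<lambda>s. exp (a * s) * h s)" "loc_integrable (\<lambda>s. exp (a * s) * h' s)"
  shows "response a h w t - response a h' w' t = response a (\<lambda>s. h s - h' s) (\<lambda>k. w k - w' k) t"
proof -
  have "accum a (\<lambda>s. h s - h' s) (\<lambda>k. w k - w' k) t = accum a h w t - accum a h' w' t" for t
    using integral_diff[of "\<lambda>s. exp (a * s) * h s" "{0..t}" "\<lambda>s. exp (a * s) * h' s"] assms
    unfolding accum_def
    by (simp add: loc_integrable_def right_diff_distrib weighted_def jump_sum_def sum_subtractf)
  then show ?thesis unfolding response_accum by (simp only: right_diff_distrib distrib_left diff_diff_eq add_diff_add)
qed

text \<open>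
  With \<open>E = exp (- a * \<omega>)\<close>, the contributions from before \<open>t\<close> enter the response with the
  weight \<open>exp (- a * (t - s)) / (1 - E)\<close> and those from after \<open>t\<close>, which come from the previous
  period, with \<open>exp (- a * (t + \<omega> - s)) / (1 - E)\<close>. Both are at most \<open>1 / (1 - E)\<close>. The bound
  keeps the integral of \<open>\<bar>h\<bar>\<close>, not its supremum: components have to be summed before
  any supremum is taken, as the supremum over \<open>t\<close> stands outside the sum in the norm.
\<close>
lemma response_bound:
  assumes "0 < a" and int: "loc_integrable (\<lambda>s. exp (a * s) * h s)" "loc_integrable (\<lambda>s. \<bar>h s\<bar>)"
    and t: "0 \<le> t" "t \<le> \<omega>"
  shows "\<bar>response a h w t\<bar> \<le> 1 / (1 - exp (- a * \<omega>)) *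
           (integral {0..\<omega>} (\<lambda>s. \<bar>h s\<bar>) + (\<Sum>k | 0 < \<tau> k \<and> \<tau> k < \<omega>. \<bar>w k\<bar>))"
proof -
  let ?k = "\<lambda>s. exp (a * s) * h s"
  define E where "E = exp (- a * \<omega>)"
  have E: "0 < E" "E < 1" using decay_less_1[OF assms(1)] by (simp_all add: E_def)
  define S where "S = {k. 0 < \<tau> k \<and> \<tau> k < \<omega>} - {k. 0 < \<tau> k \<and> \<tau> k < t}"
  \<comment> \<open>\<open>Q\<close> collects what acts during \<open>[t, \<omega>]\<close>, after the time of evaluation.\<close>
  define Q where "Q = integral {t..\<omega>} ?k + sum (weighted a w) S"
  have sub: "{k. 0 < \<tau> k \<and> \<tau> k < t} \<subseteq> {k. 0 < \<tau> k \<and> \<tau> k < \<omega>}" using t by auto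
  have split: "accum a h w \<omega> = accum a h w t + Q"
    unfolding accum_def Q_def jump_sum_def S_def
    using loc_integrable_split[OF int(1), of t \<omega>] t sum.subset_diff[OF sub, of "weighted a w"] by simp
  have part: "\<bar>integral {r..s} ?k + sum (weighted a w) A\<bar>
      \<le> exp (a * s) * (integral {r..s} (\<lambda>s. \<bar>h s\<bar>) + (\<Sum>k\<in>A. \<bar>w k\<bar>))"
    if "0 \<le> r" "finite A" "\<And>k. k \<in> A \<Longrightarrow> \<tau> k \<le> s" for r s A
  proof -
    have "norm (integral {r..s} ?k) \<le> integral {r..s} (\<lambda>u. exp (a * s) * \<bar>h u\<bar>)"
    proof (rule integral_norm_bound_integral)
      show "?k integrable_on {r..s}" using loc_integrable_sub[OF int(1) that(1)] .
      show "(\<lambda>u. exp (a * s) * \<bar>h u\<bar>) integrable_on {r..s}"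
        using integrable_on_cmult_left[OF loc_integrable_sub[OF int(2) that(1), of s], of "exp (a * s)"]
        by simp
    qed (use assms(1) in \<open>auto simp: abs_mult intro!: mult_right_mono\<close>)
    moreover have "\<bar>sum (weighted a w) A\<bar> \<le> (\<Sum>k\<in>A. exp (a * s) * \<bar>w k\<bar>)"
      using that(3) assms(1)
      by (intro order_trans[OF sum_abs] sum_mono) (auto simp: weighted_def abs_mult intro!: mult_right_mono)
    ultimately show ?thesis by (simp add: distrib_left sum_distrib_left)
  qed
  define I1 where "I1 = integral {0..t} (\<lambda>s. \<bar>h s\<bar>) + (\<Sum>k | 0 < \<tau> k \<and> \<tau> k < t. \<bar>w k\<bar>)"
  define I2 where "I2 = integral {t..\<omega>} (\<lambda>s. \<bar>h s\<bar>) + (\<Sum>k\<in>S. \<bar>w k\<bar>)"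
  have 1: "\<bar>accum a h w t\<bar> \<le> exp (a * t) * I1"
    unfolding accum_def jump_sum_def I1_def by (rule part) auto
  have 2: "\<bar>Q\<bar> \<le> exp (a * \<omega>) * I2"
    unfolding Q_def I2_def by (rule part) (use t in \<open>auto simp: S_def\<close>)
  have tot: "I1 + I2 = integral {0..\<omega>} (\<lambda>s. \<bar>h s\<bar>) + (\<Sum>k | 0 < \<tau> k \<and> \<tau> k < \<omega>. \<bar>w k\<bar>)"
    unfolding I1_def I2_def S_def
    using loc_integrable_split[OF int(2), of t \<omega>] t sum.subset_diff[OF sub, of "\<lambda>k. \<bar>w k\<bar>"] by simp
  have I2: "I2 \<ge> 0"
    unfolding I2_def using loc_integrable_sub[OF int(2) t(1)]
    by (intro add_nonneg_nonneg Henstock_Kurzweil_Integration.integral_nonneg sum_nonneg) auto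
  have "E / (1 - E) * accum a h w \<omega> + accum a h w t = 1 / (1 - E) * (accum a h w t + E * Q)"
    unfolding split using E by (simp add: field_simps)
  then have "response a h w t = 1 / (1 - E) * (exp (- a * t) * accum a h w t + exp (- a * t) * (E * Q))"
    unfolding response_accum E_def[symmetric] by (simp add: algebra_simps)
  moreover have "\<bar>exp (- a * t) * accum a h w t\<bar> \<le> I1"
  proof -
    have "\<bar>exp (- a * t) * accum a h w t\<bar> \<le> exp (- a * t) * (exp (a * t) * I1)"
      using 1 by (simp add: abs_mult)
    also have "\<dots> = I1" by (simp add: mult.assoc[symmetric] flip: exp_add)
    finally show ?thesis .
  qed
  moreover have "\<bar>exp (- a * t) * (E * Q)\<bar> \<le> I2"
  proof -
    have "\<bar>exp (- a * t) * (E * Q)\<bar> \<le> exp (- a * t) * (E * (exp (a * \<omega>) * I2))"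
      using 2 E by (simp add: abs_mult)
    also have "\<dots> = exp (- a * t) * I2" by (simp add: E_def mult.assoc[symmetric] flip: exp_add)
    also have "\<dots> \<le> 1 * I2" using I2 t assms(1) by (intro mult_right_mono) auto
    finally show ?thesis by simp
  qed
  ultimately have sum: "\<bar>exp (- a * t) * accum a h w t + exp (- a * t) * (E * Q)\<bar> \<le> I1 + I2"
    and eq: "response a h w t = 1 / (1 - E) * (exp (- a * t) * accum a h w t + exp (- a * t) * (E * Q))"
    by linarith+
  have "\<bar>response a h w t\<bar> \<le> 1 / (1 - E) * (I1 + I2)"
    unfolding eq abs_mult using E by (intro mult_mono sum) auto
  then show ?thesis by (simp add: tot E_def)
qed

lemma flow_jump_measurable:
  assumes "loc_integrable (\<lambda>s. exp (\<alpha> * s) * h s)"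
  shows "(\<lambda>t. flow \<alpha> h (K + jump_sum w t) t) \<in> borel_measurable (restrict_space borel {0..})"
proof -
  have "flow \<alpha> h K \<in> borel_measurable (restrict_space borel {0..})"
    by (rule borel_measurable_continuous_on_restrict[OF flow_continuous[OF assms]])
  moreover have "jump_sum w \<in> borel_measurable (restrict_space borel {0..})"
    by (rule measurable_restrict_space1[OF jump_sum_measurable])
  moreover have "(\<lambda>t. exp (- \<alpha> * t)) \<in> borel_measurable (restrict_space borel {0..})"
    by (intro borel_measurable_continuous_on_restrict continuous_intros)
  ultimately have "(\<lambda>t. flow \<alpha> h K t + exp (- \<alpha> * t) * jump_sum w t) \<in> borel_measurable (restrict_space borel {0..})"
    by (intro borel_measurable_add borel_measurable_times)
  then show ?thesis by (simp add: flow_def algebra_simps)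
qed

lemma flow_jump_bounded:
  assumes "loc_integrable (\<lambda>s. exp (\<alpha> * s) * h s)"
  shows "\<exists>B. \<forall>t\<in>{0..\<omega>}. \<bar>flow \<alpha> h (K + jump_sum w t) t\<bar> \<le> B"
proof -
  have "compact (flow \<alpha> h K ` {0..\<omega>})"
    by (intro compact_continuous_image continuous_on_subset[OF flow_continuous[OF assms]]) auto
  then obtain B where B: "\<And>t. t \<in> {0..\<omega>} \<Longrightarrow> \<bar>flow \<alpha> h K t\<bar> \<le> B"
    by (fastforce dest!: compact_imp_bounded simp: bounded_iff)
  define J where "J = (\<Sum>k | 0 < \<tau> k \<and> \<tau> k < \<omega>. \<bar>w k\<bar>)"
  have "\<bar>flow \<alpha> h (K + jump_sum w t) t\<bar> \<le> B + exp (\<bar>\<alpha>\<bar> * \<omega>) * J" if t: "t \<in> {0..\<omega>}" for t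
  proof -
    have "\<bar>jump_sum w t\<bar> \<le> (\<Sum>k | 0 < \<tau> k \<and> \<tau> k < t. \<bar>w k\<bar>)" unfolding jump_sum_def by (rule sum_abs)
    also have "\<dots> \<le> J" unfolding J_def by (rule sum_mono2) (use t in auto)
    finally have "\<bar>jump_sum w t\<bar> \<le> J" .
    moreover have "- \<alpha> * t \<le> \<bar>\<alpha>\<bar> * \<omega>" using t by (intro mult_mono) auto
    ultimately have "\<bar>exp (- \<alpha> * t) * jump_sum w t\<bar> \<le> exp (\<bar>\<alpha>\<bar> * \<omega>) * J"
      unfolding abs_mult by (intro mult_mono) auto
    moreover have "flow \<alpha> h (K + jump_sum w t) t = flow \<alpha> h K t + exp (- \<alpha> * t) * jump_sum w t"
      by (simp add: flow_def algebra_simps)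
    ultimately show ?thesis using B[OF t] by linarith
  qed
  then show ?thesis by blast
qed

lemma jump_at_weighted: "jump_at (weighted \<alpha> w) t = exp (\<alpha> * t) * jump_at w t"
  unfolding jump_at_def sum_distrib_left by (rule sum.cong) (auto simp: weighted_def)

lemma jump_at_shift:
  assumes "\<And>k. 0 < \<tau> k \<Longrightarrow> w (k + q) = w k" "0 \<le> t"
  shows "jump_at w (t + \<omega>) = jump_at w t"
proof (cases "t \<in> range \<tau>")
  case True
  then obtain k where k: "t = \<tau> k" by blast
  moreover have "t \<noteq> 0" using True no_impulse_0 by auto
  ultimately show ?thesis
    using assms jump_at_impulse[of k w] jump_at_impulse[of "k + q" w] period_pos by (simp add: times_shift)
next
  case False
  have "t + \<omega> \<notin> range \<tau>"
  proof
    assume "t + \<omega> \<in> range \<tau>"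
    then obtain k where k: "\<tau> k = t + \<omega>" by auto
    then have "\<tau> (k - q) = t" using past_window(3)[of k] assms(2) by simp
    then show False using False by auto
  qed
  with False show ?thesis by (simp add: jump_at_other)
qed

end

text \<open>
  The point \<open>s\<close> is independent of the function, so two periodic functions can be
  compared at the same \<open>s\<close>.
\<close>
lemma periodic_reduction:
  fixes t \<omega> :: real
  assumes "0 \<le> t" "0 < \<omega>"
  obtains s where "0 \<le> s" "s < \<omega>" "\<And>x. (\<And>t. 0 \<le> t \<Longrightarrow> x (t + \<omega>) = x t) \<Longrightarrow> x t = (x s :: 'a)"
proof
  define n where "n = nat \<lfloor>t / \<omega>\<rfloor>"
  have n: "real n \<le> t / \<omega>" "t / \<omega> < real n + 1" using assms by (auto simp: n_def)
  show s0: "0 \<le> t - n * \<omega>" "t - n * \<omega> < \<omega>" using n assms by (auto simp: field_simps)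
  fix x :: "real \<Rightarrow> 'a" assume x: "\<And>t. 0 \<le> t \<Longrightarrow> x (t + \<omega>) = x t"
  have "x (t - n * \<omega> + real m * \<omega>) = x (t - n * \<omega>)" for m
  proof (induction m)
    case (Suc m)
    have "0 \<le> t - n * \<omega> + real m * \<omega>"
      using s0(1) assms(2) by (intro add_nonneg_nonneg) auto
    from x[OF this] Suc show ?case by (simp add: algebra_simps)
  qed simp
  from this[of n] show "x t = x (t - n * \<omega>)" by simp
qed

section \<open>The piecewise constant argument\<close>

locale switching_times = impulse_times \<theta> for \<theta> :: "nat \<Rightarrow> real" +
  assumes start: "\<theta> 0 = 0"
begin

lemma pc_arg_eq:
  assumes "\<theta> k \<le> t" "t < \<theta> (Suc k)"
  shows "pc_arg \<theta> t = \<theta> k"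
proof -
  have "(THE j. \<theta> j \<le> t \<and> t < \<theta> (Suc j)) = k"
  proof (rule the_equality)
    fix j assume j: "\<theta> j \<le> t \<and> t < \<theta> (Suc j)"
    with assms have "\<theta> j < \<theta> (Suc k)" "\<theta> k < \<theta> (Suc j)" by auto
    then show "j = k" using increasing by (simp add: strict_mono_less)
  qed (use assms in auto)
  then show ?thesis by (simp add: pc_arg_def)
qed

lemma switching_interval:
  assumes "0 \<le> t"
  obtains k where "\<theta> k \<le> t" "t < \<theta> (Suc k)"
proof -
  have "eventually (\<lambda>k. \<theta> k > t) sequentially"
    using unbounded by (simp add: filterlim_at_top_dense)
  then have ex: "\<exists>k. t < \<theta> k" by (auto simp: eventually_sequentially)
  define n where "n = (LEAST k. t < \<theta> k)"
  have n: "t < \<theta> n" unfolding n_def using ex by (rule LeastI_ex)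
  then obtain k where k: "n = Suc k" using assms start by (cases n) auto
  have "\<not> t < \<theta> k" using not_less_Least[of k "\<lambda>k. t < \<theta> k"] by (simp add: n_def[symmetric] k)
  then show thesis using n k by (intro that[of k]) auto
qed

lemma switching_nonneg: "0 \<le> \<theta> k"
  using strict_mono_less_eq[OF increasing, of 0 k] start by simp

lemma pc_arg_in_range: "0 \<le> t \<Longrightarrow> pc_arg \<theta> t \<in> range \<theta>"
  by (rule switching_interval[of t]) (auto simp: pc_arg_eq)

lemma pc_arg_nonneg: "0 \<le> t \<Longrightarrow> 0 \<le> pc_arg \<theta> t"
  using pc_arg_in_range[of t] switching_nonneg by (auto simp: image_iff)

lemma pc_arg_mono: "mono_on {0..} (pc_arg \<theta>)"
proof (rule mono_onI)
  fix s t :: real assume st: "s \<in> {0..}" "t \<in> {0..}" and le: "s \<le> t"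
  obtain j where j: "\<theta> j \<le> s" "s < \<theta> (Suc j)" using switching_interval[of s] st by auto
  obtain k where k: "\<theta> k \<le> t" "t < \<theta> (Suc k)" using switching_interval[of t] st by auto
  have "\<theta> j < \<theta> (Suc k)" using le j k by simp
  then have "j \<le> k" using increasing by (simp add: strict_mono_less)
  then show "pc_arg \<theta> s \<le> pc_arg \<theta> t"
    using pc_arg_eq[OF j] pc_arg_eq[OF k] increasing by (simp add: strict_mono_less_eq)
qed

lemma pc_arg_right:
  assumes "0 \<le> t"
  shows "\<forall>\<^sub>F s in at_right t. pc_arg \<theta> s = pc_arg \<theta> t"
proof -
  obtain k where k: "\<theta> k \<le> t" "t < \<theta> (Suc k)" using switching_interval[OF assms] .
  then have "pc_arg \<theta> s = pc_arg \<theta> t" if "t < s" "s < \<theta> (Suc k)" for s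
    using pc_arg_eq[of k s] pc_arg_eq[of k t] that by simp
  then show ?thesis using k by (auto simp: eventually_at_right_field)
qed

text \<open>
  At a switching time the argument has the previous switching time as its left limit, so only
  away from switching times is the constant on the left the value at \<open>t\<close>.
\<close>
lemma pc_arg_left:
  assumes "0 < t"
  shows "\<exists>r\<ge>0. (\<forall>\<^sub>F s in at_left t. pc_arg \<theta> s = r) \<and> (t \<notin> range \<theta> \<longrightarrow> r = pc_arg \<theta> t)"
proof -
  obtain k where k: "\<theta> k \<le> t" "t < \<theta> (Suc k)" using switching_interval[of t] assms by auto
  show ?thesis
  proof (cases "\<theta> k = t")
    case True
    then obtain j where j: "k = Suc j" using assms start by (cases k) auto
    have "\<theta> j < t" using True increasing by (auto simp: j strict_mono_less)
    then have "\<forall>\<^sub>F s in at_left t. pc_arg \<theta> s = \<theta> j"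
      using pc_arg_eq[of j] True j unfolding eventually_at_left_field by (intro exI[of _ "\<theta> j"]) auto
    then show ?thesis using True switching_nonneg by auto
  next
    case False
    then have "\<forall>\<^sub>F s in at_left t. pc_arg \<theta> s = \<theta> k"
      using pc_arg_eq[of k] k unfolding eventually_at_left_field by (intro exI[of _ "\<theta> k"]) auto
    then show ?thesis using pc_arg_eq[OF k] switching_nonneg by auto
  qed
qed

lemma pc_arg_shift:
  assumes "\<And>k. \<theta> (k + m) = \<theta> k + \<omega>" "0 \<le> t"
  shows "pc_arg \<theta> (t + \<omega>) = pc_arg \<theta> t + \<omega>"
proof -
  obtain k where k: "\<theta> k \<le> t" "t < \<theta> (Suc k)" using switching_interval[OF assms(2)] .
  then have "\<theta> (k + m) \<le> t + \<omega>" "t + \<omega> < \<theta> (Suc (k + m))"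
    using assms(1)[of k] assms(1)[of "Suc k"] by auto
  from pc_arg_eq[OF this] show ?thesis using pc_arg_eq[OF k] assms(1) by simp
qed

end

section \<open>Contractions for a supremum of l1 norms\<close>

text \<open>
  The norm of the problem. It differs from the Euclidean norm of the type, but
  dominates it, and the two define the same convergence.
\<close>
definition l1 :: "real ^ 'm::finite \<Rightarrow> real" where
  "l1 v = (\<Sum>i\<in>UNIV. \<bar>v $ i\<bar>)"

lemma l1_triangle: "l1 (u - w) \<le> l1 (u - v) + l1 (v - w)"
  unfolding l1_def sum.distrib[symmetric] by (rule sum_mono) simp

lemma l1_component: "\<bar>v $ i\<bar> \<le> l1 v"
  unfolding l1_def by (rule member_le_sum) auto

lemma l1_minus: "l1 (u - v) = l1 (v - u)"
  by (simp add: l1_def abs_minus_commute)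

lemma l1_nonpos: "l1 v \<le> 0 \<Longrightarrow> v = 0"
proof -
  assume "l1 v \<le> 0"
  then have "\<bar>v $ i\<bar> \<le> 0" for i using l1_component[of v i] by linarith
  then show "v = 0" by (simp add: vec_eq_iff)
qed

lemma l1_contraction_unique:
  fixes y z :: "'s \<Rightarrow> real ^ 'm::finite"
  assumes bounded: "\<And>t. t \<in> D \<Longrightarrow> l1 (y t - z t) \<le> C"
    and contract: "\<And>C. (\<And>t. t \<in> D \<Longrightarrow> l1 (y t - z t) \<le> C) \<Longrightarrow>
        (\<And>t. t \<in> D \<Longrightarrow> l1 (y t - z t) \<le> \<kappa> * C)"
    and \<kappa>: "0 \<le> \<kappa>" "\<kappa> < 1" and t: "t \<in> D"
  shows "y t = z t"
proof -
  have "l1 (y s - z s) \<le> \<kappa> ^ n * C" if "s \<in> D" for n s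
    using that
  proof (induction n arbitrary: s)
    case (Suc n)
    show ?case using contract[OF Suc.IH Suc.prems] by (simp add: mult.assoc)
  qed (use bounded in simp)
  moreover have "(\<lambda>n. \<kappa> ^ n * C) \<longlonglongrightarrow> 0"
    using tendsto_mult_right[OF LIMSEQ_power_zero[of \<kappa>], of C] \<kappa> by simp
  ultimately have "l1 (y t - z t) \<le> 0" using t by (meson LIMSEQ_le_const)
  then show ?thesis using l1_nonpos by fastforce
qed

text \<open>
  Banach's theorem for a class \<open>A\<close> of functions compared on \<open>D\<close> by the supremum of the l1
  norms: the iterates form a geometrically convergent sequence, uniformly on \<open>D\<close>.
  Functions are not identified outside \<open>D\<close>, so the conclusion is an equation on \<open>D\<close>.
\<close>
lemma l1_contraction_fixpoint:
  fixes F :: "('s \<Rightarrow> real ^ 'm::finite) \<Rightarrow> 's \<Rightarrow> real ^ 'm"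
  assumes start: "y0 \<in> A" and maps: "\<And>y. y \<in> A \<Longrightarrow> F y \<in> A"
    and closed: "\<And>Y y e. (\<And>n. Y n \<in> A) \<Longrightarrow> e \<longlonglongrightarrow> 0 \<Longrightarrow>
        (\<And>n t. t \<in> D \<Longrightarrow> l1 (Y n t - y t) \<le> e n) \<Longrightarrow> y \<in> A"
    and bounded: "\<And>y z. y \<in> A \<Longrightarrow> z \<in> A \<Longrightarrow> \<exists>C. \<forall>t\<in>D. l1 (y t - z t) \<le> C"
    and contract: "\<And>y z C. y \<in> A \<Longrightarrow> z \<in> A \<Longrightarrow> (\<And>t. t \<in> D \<Longrightarrow> l1 (y t - z t) \<le> C) \<Longrightarrow>
        (\<And>t. t \<in> D \<Longrightarrow> l1 (F y t - F z t) \<le> \<kappa> * C)"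
    and \<kappa>: "0 \<le> \<kappa>" "\<kappa> < 1"
  shows "\<exists>y\<in>A. \<forall>t\<in>D. F y t = y t"
proof -
  have power0: "(\<lambda>n. \<kappa> ^ n * K) \<longlonglongrightarrow> 0" for K
    using tendsto_mult_right[OF LIMSEQ_power_zero[of \<kappa>], of K] \<kappa> by simp
  define Y where "Y n = (F ^^ n) y0" for n
  have YA: "Y n \<in> A" for n unfolding Y_def by (induction n) (auto simp: start maps)
  obtain C where C: "\<And>t. t \<in> D \<Longrightarrow> l1 (Y 0 t - Y 1 t) \<le> C" using bounded[OF YA YA] by meson
  have step: "t \<in> D \<Longrightarrow> l1 (Y n t - Y (Suc n) t) \<le> \<kappa> ^ n * C" for n t
  proof (induction n arbitrary: t)
    case (Suc n)
    show ?case using contract[OF YA YA Suc.IH Suc.prems] by (simp add: Y_def mult.assoc)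
  qed (use C in simp)
  have sums: "t \<in> D \<Longrightarrow> l1 (Y n t - Y (n + m) t) \<le> \<kappa> ^ n * (C / (1 - \<kappa>)) * (1 - \<kappa> ^ m)" for n m t
  proof (induction m)
    case (Suc m)
    have "l1 (Y n t - Y (n + Suc m) t) \<le> \<kappa> ^ n * (C / (1 - \<kappa>)) * (1 - \<kappa> ^ m) + \<kappa> ^ (n + m) * C"
      using l1_triangle[of "Y n t" "Y (n + Suc m) t" "Y (n + m) t"] Suc step[of t "n + m"] by simp
    also have "\<dots> = \<kappa> ^ n * (C / (1 - \<kappa>)) * (1 - \<kappa> ^ Suc m)"
      using \<kappa> by (simp add: field_simps power_add)
    finally show ?case .
  qed (simp add: l1_def)
  define K where "K = \<bar>C\<bar> / (1 - \<kappa>)"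
  have tail: "l1 (Y n t - Y (n + m) t) \<le> \<kappa> ^ n * K" if "t \<in> D" for n m t
  proof -
    have "C / (1 - \<kappa>) * (1 - \<kappa> ^ m) \<le> K * 1"
      unfolding K_def using \<kappa> by (intro mult_mono divide_right_mono) (auto simp: power_le_one)
    then have "\<kappa> ^ n * (C / (1 - \<kappa>) * (1 - \<kappa> ^ m)) \<le> \<kappa> ^ n * (K * 1)"
      using \<kappa> by (intro mult_left_mono) auto
    then show ?thesis using sums[OF that, of n m] by (simp add: mult.assoc)
  qed
  define y where "y t = lim (\<lambda>n. Y n t)" for t
  have lim: "(\<lambda>n. Y n t) \<longlonglongrightarrow> y t" if t: "t \<in> D" for t
  proof -
    have "Cauchy (\<lambda>n. Y n t)"
    proof (rule CauchyI')
      fix e :: real assume "0 < e"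
      then obtain M where M: "\<And>n. n \<ge> M \<Longrightarrow> \<kappa> ^ n * K < e"
        using order_tendstoD(2)[OF power0, of e K] by (auto simp: eventually_sequentially)
      have "dist (Y m t) (Y n t) < e" if "m \<ge> M" "n > m" for m n
      proof -
        have "dist (Y m t) (Y n t) \<le> l1 (Y m t - Y n t)"
          unfolding l1_def dist_norm by (rule norm_le_l1_cart)
        also have "\<dots> \<le> \<kappa> ^ m * K" using tail[OF t, of m "n - m"] that(2) by simp
        also have "\<dots> < e" using M[OF that(1)] .
        finally show ?thesis .
      qed
      then show "\<exists>M. \<forall>m\<ge>M. \<forall>n>m. dist (Y m t) (Y n t) < e" by blast
    qed
    from Cauchy_convergent[OF this] show ?thesis unfolding y_def by (simp only: convergent_LIMSEQ_iff)
  qed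
  have near: "l1 (Y n t - y t) \<le> \<kappa> ^ n * K" if t: "t \<in> D" for n t
  proof (rule tendsto_upperbound)
    have "(\<lambda>m. Y (m + n) t) \<longlonglongrightarrow> y t" using lim[OF t] by (rule LIMSEQ_ignore_initial_segment)
    then show "(\<lambda>m. l1 (Y n t - Y (m + n) t)) \<longlonglongrightarrow> l1 (Y n t - y t)"
      unfolding l1_def by (intro tendsto_intros)
    show "\<forall>\<^sub>F m in sequentially. l1 (Y n t - Y (m + n) t) \<le> \<kappa> ^ n * K"
      using tail[OF t, of n] by (simp add: add.commute)
  qed simp
  have yA: "y \<in> A" by (rule closed[OF YA power0 near])
  have "F y t = y t" if t: "t \<in> D" for t
  proof -
    have "l1 (y t - F y t) \<le> 2 * (\<kappa> * (\<kappa> ^ n * K))" for n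
    proof -
      have "l1 (F (Y n) t - F y t) \<le> \<kappa> * (\<kappa> ^ n * K)"
        by (rule contract[OF YA yA near t])
      moreover have "l1 (y t - Y (Suc n) t) \<le> \<kappa> * (\<kappa> ^ n * K)"
        using near[OF t, of "Suc n"] by (simp add: l1_minus mult.assoc)
      moreover have "F (Y n) t = Y (Suc n) t" by (simp add: Y_def)
      ultimately show ?thesis using l1_triangle[of "y t" "F y t" "Y (Suc n) t"] by simp
    qed
    moreover have "(\<lambda>n. 2 * (\<kappa> * (\<kappa> ^ n * K))) \<longlonglongrightarrow> 0"
      using tendsto_mult_left[OF power0[of K], of "2 * \<kappa>"] by (simp add: mult.assoc)
    ultimately have "l1 (y t - F y t) \<le> 0" by (meson LIMSEQ_le_const)
    then show ?thesis using l1_nonpos by fastforce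
  qed
  with yA show ?thesis by (intro bexI[of _ y] ballI)
qed

section \<open>Vector-valued derivatives and one-sided limits\<close>

lemma has_vector_derivative_vecI:
  fixes x :: "real \<Rightarrow> real ^ 'm::finite"
  assumes "\<And>i. ((\<lambda>t. x t $ i) has_vector_derivative v $ i) (at t within S)"
  shows "(x has_vector_derivative v) (at t within S)"
  unfolding has_vector_derivative_def
proof (subst has_derivative_componentwise_within, rule ballI)
  fix u :: "real ^ 'm" assume "u \<in> Basis"
  then obtain i where u: "u = axis i 1" by (auto simp: Basis_vec_def)
  show "((\<lambda>t. x t \<bullet> u) has_derivative (\<lambda>s. (s *\<^sub>R v) \<bullet> u)) (at t within S)"
    using assms[of i] by (simp add: u inner_axis has_vector_derivative_def)
qed

lemma has_vector_derivative_vecD: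
  fixes x :: "real \<Rightarrow> real ^ 'm::finite"
  assumes "(x has_vector_derivative v) (at t within S)"
  shows "((\<lambda>t. x t $ i) has_vector_derivative v $ i) (at t within S)"
  using bounded_linear.has_vector_derivative[OF bounded_linear_vec_nth assms] .

lemma has_vector_derivative_transform_eventually:
  assumes "(x has_vector_derivative v) (at t within S)"
    and "\<forall>\<^sub>F s in at t within S. x s = y s" "x t = y t"
  shows "(y has_vector_derivative v) (at t within S)"
proof -
  have lim: "((\<lambda>s. (1 / norm (s - t)) *\<^sub>R (x s - (x t + (s - t) *\<^sub>R v))) \<longlongrightarrow> 0) (at t within S)"
    and lin: "bounded_linear (\<lambda>s. s *\<^sub>R v)"
    using assms(1) unfolding has_vector_derivative_def has_derivative_within by blast+
  have "\<forall>\<^sub>F s in at t within S. (1 / norm (s - t)) *\<^sub>R (x s - (x t + (s - t) *\<^sub>R v))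
      = (1 / norm (s - t)) *\<^sub>R (y s - (y t + (s - t) *\<^sub>R v))"
    using assms(2) by eventually_elim (simp add: assms(3))
  from Lim_transform_eventually[OF lim this] lin show ?thesis
    unfolding has_vector_derivative_def has_derivative_within by blast
qed

lemma isCont_left_right: "isCont x t \<longleftrightarrow> (x \<longlongrightarrow> x t) (at_left t) \<and> (x \<longlongrightarrow> x t) (at_right t)"
  for x :: "real \<Rightarrow> 'a::topological_space"
  by (simp add: isCont_def filterlim_at_split)

section \<open>The periodic operator and its fixed point\<close>

text \<open>
  The constants \<open>\<mu>\<close>, \<open>k2\<close>, \<open>\<gamma>\<close> are arbitrary bounds here instead of maxima and minima, and the
  contraction condition is the one that the supremum norm calls for, without the factor \<open>\<lambda>\<close>.
\<close>
locale impulsive_network =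
  periodic_impulses \<tau> \<omega> q + switch: switching_times \<theta>
  for \<tau> \<theta> :: "nat \<Rightarrow> real" and \<omega> :: real and q :: nat +
  fixes p1 :: nat and a d Lf Lg :: "'m::finite \<Rightarrow> real" and b c :: "'m \<Rightarrow> 'm \<Rightarrow> real"
    and f g :: "'m \<Rightarrow> real \<Rightarrow> real" and I :: "'m \<Rightarrow> nat \<Rightarrow> real \<Rightarrow> real"
    and l \<mu> k2 \<gamma> :: real
  assumes disjoint: "range \<tau> \<inter> range \<theta> = {}"
    and switch_shift: "\<And>k. \<theta> (k + p1) = \<theta> k + \<omega>"
    and impulse_shift: "\<And>i k. I i (k + q) = I i k"
    and decay: "\<And>i. \<gamma> \<le> a i" "0 < \<gamma>"
    and f_lipschitz: "\<And>j. 0 \<le> Lf j" "\<And>j u v. \<bar>f j u - f j v\<bar> \<le> Lf j * \<bar>u - v\<bar>"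
    and g_lipschitz: "\<And>j. 0 \<le> Lg j" "\<And>j u v. \<bar>g j u - g j v\<bar> \<le> Lg j * \<bar>u - v\<bar>"
    and I_lipschitz: "0 \<le> l" "\<And>i k u v. \<bar>I i k u - I i k v\<bar> \<le> l * \<bar>u - v\<bar>"
    and f_weight: "\<And>j. Lf j * (\<Sum>i\<in>UNIV. \<bar>b i j\<bar>) \<le> \<mu>"
    and g_weight: "\<And>j. Lg j * (\<Sum>i\<in>UNIV. \<bar>c i j\<bar>) \<le> k2"
    and contraction: "1 / (1 - exp (- \<gamma> * \<omega>)) * (\<omega> * (\<mu> + k2) + l * real q) < 1"
begin

lemma a_pos: "0 < a i"
  using decay less_le_trans by blast

text \<open>The index type is nonempty, so \<open>undefined\<close> serves as some index.\<close>
lemma weights_nonneg: "0 \<le> \<mu>" "0 \<le> k2"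
  using f_weight[of undefined] g_weight[of undefined] f_lipschitz(1)[of undefined] g_lipschitz(1)[of undefined]
  by (meson order_trans mult_nonneg_nonneg sum_nonneg abs_ge_zero)+

definition forcing :: "(real \<Rightarrow> real ^ 'm) \<Rightarrow> 'm \<Rightarrow> real \<Rightarrow> real" where
  "forcing y i t = (\<Sum>j\<in>UNIV. b i j * f j (y t $ j))
     + (\<Sum>j\<in>UNIV. c i j * g j (y (pc_arg \<theta> t) $ j)) + d i"

definition kick :: "(real \<Rightarrow> real ^ 'm) \<Rightarrow> 'm \<Rightarrow> nat \<Rightarrow> real" where
  "kick y i k = I i k (y (\<tau> k) $ i)"

definition periodic_operator :: "(real \<Rightarrow> real ^ 'm) \<Rightarrow> real \<Rightarrow> real ^ 'm" where
  "periodic_operator y t = (\<chi> i. response (a i) (forcing y i) (kick y i) t)"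

text \<open>
  The class on which the operator acts. Periodicity belongs to it because the operator
  preserves it and because it reduces every estimate to a single period.
\<close>
definition admissible :: "(real \<Rightarrow> real ^ 'm) set" where
  "admissible = {y. (\<forall>i. (\<lambda>t. y t $ i) \<in> borel_measurable (restrict_space borel {0..})) \<and>
     (\<exists>B. \<forall>t\<ge>0. l1 (y t) \<le> B) \<and> (\<forall>t\<ge>0. y (t + \<omega>) = y t)}"

lemma continuous_f: "continuous_on UNIV (f j)" and continuous_g: "continuous_on UNIV (g j)"
proof -
  have lip: "continuous_on UNIV h" if "\<And>u v. \<bar>h u - h v\<bar> \<le> L * \<bar>u - v\<bar>" "0 \<le> L" for h :: "real \<Rightarrow> real" and L
  proof -
    have "L-lipschitz_on UNIV h" using that by (intro lipschitz_onI) (auto simp: dist_real_def)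
    then show ?thesis by (rule lipschitz_on_continuous_on)
  qed
  show "continuous_on UNIV (f j)" "continuous_on UNIV (g j)"
    by (rule lip[OF f_lipschitz(2) f_lipschitz(1)], rule lip[OF g_lipschitz(2) g_lipschitz(1)])
qed

text \<open>
  Interchanging the sums over \<open>i\<close> and \<open>j\<close> turns the Lipschitz bounds into column sums of the
  weight matrices; this is why \<open>\<mu>\<close> and \<open>k2\<close> bound column sums. The delayed difference is
  bounded by the same \<open>C\<close> since it is again a difference at a nonnegative time.
\<close>
lemma forcing_difference:
  assumes "\<And>t. 0 \<le> t \<Longrightarrow> l1 (y t - z t) \<le> C" "0 \<le> t"
  shows "(\<Sum>i\<in>UNIV. \<bar>forcing y i t - forcing z i t\<bar>) \<le> (\<mu> + k2) * C"
proof -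
  have col: "(\<Sum>i\<in>UNIV. \<Sum>j\<in>UNIV. \<bar>w i j\<bar> * (L j * \<bar>v $ j\<bar>)) \<le> M * l1 v"
    if "\<And>j. L j * (\<Sum>i\<in>UNIV. \<bar>w i j\<bar>) \<le> M" for w :: "'m \<Rightarrow> 'm \<Rightarrow> real" and L M and v :: "real ^ 'm"
  proof -
    have "(\<Sum>i\<in>UNIV. \<Sum>j\<in>UNIV. \<bar>w i j\<bar> * (L j * \<bar>v $ j\<bar>)) = (\<Sum>j\<in>UNIV. (L j * (\<Sum>i\<in>UNIV. \<bar>w i j\<bar>)) * \<bar>v $ j\<bar>)"
      by (subst sum.swap) (simp add: sum_distrib_left sum_distrib_right ac_simps)
    also have "\<dots> \<le> (\<Sum>j\<in>UNIV. M * \<bar>v $ j\<bar>)" by (intro sum_mono mult_right_mono that) auto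
    finally show ?thesis by (simp add: l1_def sum_distrib_left)
  qed
  let ?s = "pc_arg \<theta> t"
  have "\<bar>forcing y i t - forcing z i t\<bar> \<le>
      (\<Sum>j\<in>UNIV. \<bar>b i j\<bar> * (Lf j * \<bar>(y t - z t) $ j\<bar>)) + (\<Sum>j\<in>UNIV. \<bar>c i j\<bar> * (Lg j * \<bar>(y ?s - z ?s) $ j\<bar>))" for i
  proof -
    have "forcing y i t - forcing z i t = (\<Sum>j\<in>UNIV. b i j * (f j (y t $ j) - f j (z t $ j)))
        + (\<Sum>j\<in>UNIV. c i j * (g j (y ?s $ j) - g j (z ?s $ j)))"
      by (simp add: forcing_def right_diff_distrib sum_subtractf)
    moreover have "\<bar>\<Sum>j\<in>UNIV. b i j * (f j (y t $ j) - f j (z t $ j))\<bar> \<le> (\<Sum>j\<in>UNIV. \<bar>b i j\<bar> * (Lf j * \<bar>(y t - z t) $ j\<bar>))"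
      by (intro order_trans[OF sum_abs] sum_mono) (simp add: abs_mult mult_left_mono f_lipschitz)
    moreover have "\<bar>\<Sum>j\<in>UNIV. c i j * (g j (y ?s $ j) - g j (z ?s $ j))\<bar> \<le> (\<Sum>j\<in>UNIV. \<bar>c i j\<bar> * (Lg j * \<bar>(y ?s - z ?s) $ j\<bar>))"
      by (intro order_trans[OF sum_abs] sum_mono) (simp add: abs_mult mult_left_mono g_lipschitz)
    ultimately show ?thesis by linarith
  qed
  then have "(\<Sum>i\<in>UNIV. \<bar>forcing y i t - forcing z i t\<bar>) \<le>
      (\<Sum>i\<in>UNIV. (\<Sum>j\<in>UNIV. \<bar>b i j\<bar> * (Lf j * \<bar>(y t - z t) $ j\<bar>)) + (\<Sum>j\<in>UNIV. \<bar>c i j\<bar> * (Lg j * \<bar>(y ?s - z ?s) $ j\<bar>)))"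
    by (rule sum_mono)
  also have "\<dots> \<le> \<mu> * l1 (y t - z t) + k2 * l1 (y ?s - z ?s)"
    unfolding sum.distrib by (intro add_mono col f_weight g_weight)
  also have "\<dots> \<le> \<mu> * C + k2 * C"
    using assms switch.pc_arg_nonneg weights_nonneg by (intro add_mono mult_left_mono) auto
  finally show ?thesis by (simp add: distrib_right)
qed

lemma kick_difference:
  assumes "\<And>t. 0 \<le> t \<Longrightarrow> l1 (y t - z t) \<le> C" "0 < \<tau> k"
  shows "(\<Sum>i\<in>UNIV. \<bar>kick y i k - kick z i k\<bar>) \<le> l * C"
proof -
  have "(\<Sum>i\<in>UNIV. \<bar>kick y i k - kick z i k\<bar>) \<le> (\<Sum>i\<in>UNIV. l * \<bar>(y (\<tau> k) - z (\<tau> k)) $ i\<bar>)"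
    unfolding kick_def by (intro sum_mono) (simp add: I_lipschitz)
  also have "\<dots> = l * l1 (y (\<tau> k) - z (\<tau> k))" by (simp add: l1_def sum_distrib_left)
  also have "\<dots> \<le> l * C" using assms I_lipschitz(1) by (intro mult_left_mono) auto
  finally show ?thesis .
qed

text \<open>The argument \<open>pc_arg \<theta>\<close> is monotone on the half-line, so composing with it is harmless.\<close>
lemma forcing_measurable:
  assumes "y \<in> admissible"
  shows "forcing y i \<in> borel_measurable (restrict_space borel {0..})"
proof -
  have y: "(\<lambda>t. y t $ j) \<in> borel_measurable (restrict_space borel {0..})" for j
    using assms by (simp add: admissible_def)
  have "pc_arg \<theta> \<in> borel_measurable (restrict_space borel {0..})"
    by (rule borel_measurable_mono_on_fnc[OF switch.pc_arg_mono])
  then have "pc_arg \<theta> \<in> measurable (restrict_space borel {0..}) (restrict_space borel {0..})"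
    by (rule measurable_restrict_space2[rotated]) (auto simp: space_restrict_space switch.pc_arg_nonneg)
  from measurable_compose[OF this y]
  have yp: "(\<lambda>t. y (pc_arg \<theta> t) $ j) \<in> borel_measurable (restrict_space borel {0..})" for j .
  have "(\<lambda>t. f j (y t $ j)) \<in> borel_measurable (restrict_space borel {0..})"
    "(\<lambda>t. g j (y (pc_arg \<theta> t) $ j)) \<in> borel_measurable (restrict_space borel {0..})" for j
    by (rule measurable_compose[OF y borel_measurable_continuous_onI[OF continuous_f]],
        rule measurable_compose[OF yp borel_measurable_continuous_onI[OF continuous_g]])
  then show ?thesis unfolding forcing_def by (auto intro!: borel_measurable_add borel_measurable_sum borel_measurable_times)
qed

text \<open>Comparison with the zero function, for which the forcing is constant in time.\<close>
lemma forcing_bounded: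
  assumes "y \<in> admissible"
  obtains B where "\<And>t. 0 \<le> t \<Longrightarrow> \<bar>forcing y i t\<bar> \<le> B"
proof -
  obtain C where C: "\<And>t. 0 \<le> t \<Longrightarrow> l1 (y t - 0) \<le> C"
    using assms by (auto simp: admissible_def)
  define z :: "real \<Rightarrow> real ^ 'm" where "z = (\<lambda>_. 0)"
  have "\<bar>forcing y i t\<bar> \<le> (\<mu> + k2) * C + \<bar>forcing z i 0\<bar>" if "0 \<le> t" for t
  proof -
    have "\<bar>forcing y i t - forcing z i t\<bar> \<le> (\<Sum>i\<in>UNIV. \<bar>forcing y i t - forcing z i t\<bar>)"
      by (rule member_le_sum) auto
    also have "\<dots> \<le> (\<mu> + k2) * C"
      by (rule forcing_difference) (use C that in \<open>auto simp: z_def\<close>)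
    also have "forcing z i t = forcing z i 0" by (simp add: forcing_def z_def)
    finally show ?thesis by linarith
  qed
  then show thesis by (rule that)
qed

lemma forcing_integrable:
  assumes "y \<in> admissible"
  shows "loc_integrable (\<lambda>s. exp (\<alpha> * s) * forcing y i s)"
  using forcing_bounded[OF assms] exp_weighted_loc_integrable[OF forcing_measurable[OF assms]] by metis

lemma forcing_difference_integrable:
  assumes "y \<in> admissible" "z \<in> admissible"
  shows "loc_integrable (\<lambda>s. \<bar>forcing y i s - forcing z i s\<bar>)"
proof -
  obtain B where B: "\<And>t. 0 \<le> t \<Longrightarrow> \<bar>forcing y i t\<bar> \<le> B" using forcing_bounded[OF assms(1)] by blast
  obtain C where C: "\<And>t. 0 \<le> t \<Longrightarrow> \<bar>forcing z i t\<bar> \<le> C" using forcing_bounded[OF assms(2)] by blast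
  show ?thesis
  proof (rule measurable_bounded_loc_integrable)
    show "(\<lambda>s. \<bar>forcing y i s - forcing z i s\<bar>) \<in> borel_measurable (restrict_space borel {0..})"
      by (intro borel_measurable_abs borel_measurable_diff forcing_measurable assms)
    show "\<bar>\<bar>forcing y i t - forcing z i t\<bar>\<bar> \<le> B + C" if "0 \<le> t" for t
      using B[OF that] C[OF that] by simp
  qed
qed

lemma forcing_periodic:
  assumes "\<And>t. 0 \<le> t \<Longrightarrow> y (t + \<omega>) = y t" "0 \<le> t"
  shows "forcing y i (t + \<omega>) = forcing y i t"
  unfolding forcing_def switch.pc_arg_shift[OF switch_shift assms(2)]
  using assms switch.pc_arg_nonneg by simp

lemma kick_periodic:
  assumes "\<And>t. 0 \<le> t \<Longrightarrow> y (t + \<omega>) = y t" "0 < \<tau> k"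
  shows "kick y i (k + q) = kick y i k"
  using assms by (simp add: kick_def impulse_shift times_shift)

lemma operator_periodic:
  assumes "y \<in> admissible" "0 \<le> t"
  shows "periodic_operator y (t + \<omega>) = periodic_operator y t"
proof -
  have "response (a i) (forcing y i) (kick y i) (t + \<omega>) = response (a i) (forcing y i) (kick y i) t" for i
    by (rule response_periodic[OF a_pos forcing_integrable[OF assms(1)]])
      (use assms in \<open>auto simp: admissible_def intro: forcing_periodic kick_periodic\<close>)
  then show ?thesis by (simp add: periodic_operator_def)
qed

text \<open>
  By periodicity it suffices to estimate at a point \<open>s\<close> of the first period. There the scalar
  bound applies to the difference of the two responses in each component; after summation over
  the components, \<open>forcing_difference\<close> acts under the integral and \<open>kick_difference\<close> at each of
  the \<open>q\<close> impulses.
\<close>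
lemma operator_contraction:
  assumes adm: "y \<in> admissible" "z \<in> admissible"
    and C: "\<And>t. 0 \<le> t \<Longrightarrow> l1 (y t - z t) \<le> C" and "0 \<le> t"
  shows "l1 (periodic_operator y t - periodic_operator z t)
    \<le> 1 / (1 - exp (- \<gamma> * \<omega>)) * (\<omega> * (\<mu> + k2) + l * real q) * C"
proof -
  let ?R = "1 / (1 - exp (- \<gamma> * \<omega>))" and ?K = "{k. 0 < \<tau> k \<and> \<tau> k < \<omega>}"
  define w where "w i s = \<bar>forcing y i s - forcing z i s\<bar>" for i s
  define v where "v i k = \<bar>kick y i k - kick z i k\<bar>" for i k
  obtain s where s: "0 \<le> s" "s < \<omega>"
    and red: "\<And>x. (\<And>t. 0 \<le> t \<Longrightarrow> x (t + \<omega>) = x t) \<Longrightarrow> x t = (x s :: real ^ 'm)"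
    using periodic_reduction[OF \<open>0 \<le> t\<close> period_pos, where ?'a = "real ^ 'm"] by metis
  have w_int: "loc_integrable (w i)" for i
    unfolding w_def by (rule forcing_difference_integrable[OF adm])
  have comp: "\<bar>(periodic_operator y s - periodic_operator z s) $ i\<bar> \<le> ?R * (integral {0..\<omega>} (w i) + sum (v i) ?K)" for i
  proof -
    have "\<bar>(periodic_operator y s - periodic_operator z s) $ i\<bar> \<le>
        1 / (1 - exp (- a i * \<omega>)) * (integral {0..\<omega>} (w i) + sum (v i) ?K)"
    proof -
      have "loc_integrable (\<lambda>s. exp (a i * s) * (forcing y i s - forcing z i s))"
        using forcing_integrable[OF adm(1), of "a i" i] forcing_integrable[OF adm(2), of "a i" i]
        by (auto simp: loc_integrable_def right_diff_distrib intro: integrable_diff)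
      from response_bound[OF a_pos this forcing_difference_integrable[OF adm] s(1) less_imp_le[OF s(2)]]
      show ?thesis unfolding w_def v_def periodic_operator_def
        by (simp add: response_diff[OF forcing_integrable[OF adm(1)] forcing_integrable[OF adm(2)]])
    qed
    also have "\<dots> \<le> ?R * (integral {0..\<omega>} (w i) + sum (v i) ?K)"
    proof (rule mult_right_mono)
      have "exp (- a i * \<omega>) \<le> exp (- \<gamma> * \<omega>)" using decay period_pos by simp
      moreover have "exp (- \<gamma> * \<omega>) < 1" using decay_less_1[OF decay(2)] .
      ultimately show "1 / (1 - exp (- a i * \<omega>)) \<le> ?R" by (intro divide_left_mono) auto
      have "0 \<le> integral {0..\<omega>} (w i)"
        using w_int by (intro Henstock_Kurzweil_Integration.integral_nonneg) (auto simp: loc_integrable_def w_def)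
      then show "0 \<le> integral {0..\<omega>} (w i) + sum (v i) ?K"
        by (intro add_nonneg_nonneg sum_nonneg) (auto simp: v_def)
    qed
    finally show ?thesis .
  qed
  have "l1 (periodic_operator y t - periodic_operator z t) = l1 (periodic_operator y s - periodic_operator z s)"
    using red[of "\<lambda>t. periodic_operator y t - periodic_operator z t"] by (simp add: operator_periodic adm)
  also have "\<dots> \<le> (\<Sum>i\<in>UNIV. ?R * (integral {0..\<omega>} (w i) + sum (v i) ?K))"
    unfolding l1_def by (intro sum_mono comp)
  also have "\<dots> = ?R * (integral {0..\<omega>} (\<lambda>s. \<Sum>i\<in>UNIV. w i s) + (\<Sum>k\<in>?K. \<Sum>i\<in>UNIV. v i k))"
    using w_int unfolding sum_distrib_left[symmetric] sum.distrib
    by (subst integral_sum) (auto simp: loc_integrable_def sum.swap[of v])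
  also have "\<dots> \<le> ?R * (\<omega> * ((\<mu> + k2) * C) + real q * (l * C))"
  proof (intro mult_left_mono add_mono)
    have "integral {0..\<omega>} (\<lambda>s. \<Sum>i\<in>UNIV. w i s) \<le> integral {0..\<omega>} (\<lambda>s. (\<mu> + k2) * C)"
    proof (rule integral_le)
      show "(\<lambda>s. \<Sum>i\<in>UNIV. w i s) integrable_on {0..\<omega>}"
        using w_int by (intro integrable_sum) (auto simp: loc_integrable_def)
      show "(\<Sum>i\<in>UNIV. w i s) \<le> (\<mu> + k2) * C" if "s \<in> {0..\<omega>}" for s
        unfolding w_def using that by (intro forcing_difference C) auto
    qed (rule integrable_const_ivl)
    then show "integral {0..\<omega>} (\<lambda>s. \<Sum>i\<in>UNIV. w i s) \<le> \<omega> * ((\<mu> + k2) * C)"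
      using period_pos by (simp add: ac_simps)
    have "(\<Sum>k\<in>?K. \<Sum>i\<in>UNIV. v i k) \<le> (\<Sum>k\<in>?K. l * C)"
      unfolding v_def by (intro sum_mono kick_difference C) auto
    then show "(\<Sum>k\<in>?K. \<Sum>i\<in>UNIV. v i k) \<le> real q * (l * C)" by (simp add: window_count)
    show "0 \<le> ?R" using decay_less_1[OF decay(2)] by simp
  qed
  also have "\<omega> * ((\<mu> + k2) * C) + real q * (l * C) = (\<omega> * (\<mu> + k2) + l * real q) * C"
    by (simp add: algebra_simps)
  finally show ?thesis by (simp only: mult.assoc)
qed

lemma zero_admissible: "(\<lambda>_. 0) \<in> admissible"
  by (auto simp: admissible_def l1_def intro: exI[of _ 0])

lemma admissible_difference_bounded:
  assumes "y \<in> admissible" "z \<in> admissible"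
  obtains C where "\<And>t. 0 \<le> t \<Longrightarrow> l1 (y t - z t) \<le> C"
proof -
  obtain B B' where "\<And>t. 0 \<le> t \<Longrightarrow> l1 (y t) \<le> B" "\<And>t. 0 \<le> t \<Longrightarrow> l1 (z t) \<le> B'"
    using assms by (auto simp: admissible_def)
  then have "l1 (y t - z t) \<le> B + B'" if "0 \<le> t" for t
    using l1_triangle[of "y t" "z t" 0] that l1_minus[of 0 "z t"] by fastforce
  then show thesis by (rule that)
qed

lemma admissibleI:
  assumes "\<And>i. (\<lambda>t. y t $ i) \<in> borel_measurable (restrict_space borel {0..})"
    and per: "\<And>t. 0 \<le> t \<Longrightarrow> y (t + \<omega>) = y t"
    and "\<And>i. \<exists>B. \<forall>t\<in>{0..\<omega>}. \<bar>y t $ i\<bar> \<le> B"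
  shows "y \<in> admissible"
proof -
  obtain B where B: "\<And>i t. t \<in> {0..\<omega>} \<Longrightarrow> \<bar>y t $ i\<bar> \<le> B i" using assms(3) by metis
  have "l1 (y t) \<le> (\<Sum>i\<in>UNIV. B i)" if t: "0 \<le> t" for t
  proof -
    obtain s where s: "0 \<le> s" "s < \<omega>"
      and red: "\<And>x. (\<And>t. 0 \<le> t \<Longrightarrow> x (t + \<omega>) = x t) \<Longrightarrow> x t = (x s :: real ^ 'm)"
      using periodic_reduction[OF t period_pos, where ?'a = "real ^ 'm"] by metis
    have "y t = y s" by (rule red) (rule per)
    then show ?thesis using B[of s] s unfolding l1_def by (auto intro!: sum_mono)
  qed
  then show ?thesis using assms by (auto simp: admissible_def)
qed

lemma operator_admissible:
  assumes "y \<in> admissible"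
  shows "periodic_operator y \<in> admissible"
proof (rule admissibleI)
  show "(\<lambda>t. periodic_operator y t $ i) \<in> borel_measurable (restrict_space borel {0..})"
    "\<exists>B. \<forall>t\<in>{0..\<omega>}. \<bar>periodic_operator y t $ i\<bar> \<le> B" for i
    unfolding periodic_operator_def response_def vec_lambda_beta
    by (intro flow_jump_measurable flow_jump_bounded forcing_integrable assms)+
qed (rule operator_periodic[OF assms])

text \<open>
  Measurability, periodicity and boundedness pass to uniform limits; this provides the
  completeness behind the fixed point theorem.
\<close>
lemma admissible_closed:
  assumes Y: "\<And>n. Y n \<in> admissible" and e: "e \<longlonglongrightarrow> 0"
    and near: "\<And>n t. t \<in> {0..} \<Longrightarrow> l1 (Y n t - y t) \<le> e n"
  shows "y \<in> admissible"
proof -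
  have lim: "(\<lambda>n. Y n t $ i) \<longlonglongrightarrow> y t $ i" if "0 \<le> t" for t i
  proof (rule LIM_zero_cancel, rule Lim_null_comparison[OF _ e], rule always_eventually, rule allI)
    fix n
    have "\<bar>(Y n t - y t) $ i\<bar> \<le> e n" using l1_component near[of t n] that order_trans by fastforce
    then show "norm (Y n t $ i - y t $ i) \<le> e n" by simp
  qed
  have "(\<lambda>t. y t $ i) \<in> borel_measurable (restrict_space borel {0..})" for i
    by (rule borel_measurable_LIMSEQ_real[where u = "\<lambda>n t. Y n t $ i"])
      (use lim Y in \<open>auto simp: space_restrict_space admissible_def\<close>)
  moreover have "y (t + \<omega>) = y t" if "0 \<le> t" for t
  proof (rule vec_eq_iff[THEN iffD2], rule allI)
    fix i
    have "(\<lambda>n. Y n t $ i) \<longlonglongrightarrow> y (t + \<omega>) $ i"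
      using lim[of "t + \<omega>" i] that period_pos Y by (simp add: admissible_def)
    then show "y (t + \<omega>) $ i = y t $ i" using lim[OF that] LIMSEQ_unique by blast
  qed
  moreover have "\<exists>B. \<forall>t\<ge>0. l1 (y t) \<le> B"
  proof -
    obtain B where "\<And>t. 0 \<le> t \<Longrightarrow> l1 (Y 0 t) \<le> B" using Y[of 0] by (auto simp: admissible_def)
    then have "l1 (y t) \<le> e 0 + B" if "0 \<le> t" for t
      using l1_triangle[of "y t" 0 "Y 0 t"] near[of t 0] l1_minus[of "y t"] that by fastforce
    then show ?thesis by blast
  qed
  ultimately show ?thesis by (simp add: admissible_def)
qed

lemma contraction_factor_nonneg: "0 \<le> 1 / (1 - exp (- \<gamma> * \<omega>)) * (\<omega> * (\<mu> + k2) + l * real q)"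
  using decay_less_1[OF decay(2)] period_pos weights_nonneg I_lipschitz(1)
  by (intro mult_nonneg_nonneg add_nonneg_nonneg) auto

lemma fixed_point_exists: "\<exists>y\<in>admissible. \<forall>t\<ge>0. periodic_operator y t = y t"
proof -
  have "\<exists>y\<in>admissible. \<forall>t\<in>{0..}. periodic_operator y t = y t"
  proof (rule l1_contraction_fixpoint[OF zero_admissible operator_admissible admissible_closed _ _ contraction_factor_nonneg contraction])
    show "\<exists>C. \<forall>t\<in>{0..}. l1 (y t - z t) \<le> C" if "y \<in> admissible" "z \<in> admissible" for y z
      using admissible_difference_bounded[OF that] by (metis atLeast_iff)
    show "l1 (periodic_operator y t - periodic_operator z t)
        \<le> 1 / (1 - exp (- \<gamma> * \<omega>)) * (\<omega> * (\<mu> + k2) + l * real q) * C"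
      if "y \<in> admissible" "z \<in> admissible" "\<And>t. t \<in> {0..} \<Longrightarrow> l1 (y t - z t) \<le> C" "t \<in> {0..}" for y z C t
      by (rule operator_contraction[OF that(1,2)]) (use that(3,4) in auto)
  qed
  then show ?thesis by (simp add: Ball_def)
qed

lemma fixed_point_unique:
  assumes "y \<in> admissible" "z \<in> admissible"
    and "\<And>t. 0 \<le> t \<Longrightarrow> periodic_operator y t = y t" "\<And>t. 0 \<le> t \<Longrightarrow> periodic_operator z t = z t"
    and "0 \<le> t"
  shows "y t = z t"
proof -
  obtain C where C: "\<And>t. 0 \<le> t \<Longrightarrow> l1 (y t - z t) \<le> C"
    using admissible_difference_bounded[OF assms(1,2)] by blast
  show ?thesis
  proof (rule l1_contraction_unique[OF _ _ contraction_factor_nonneg contraction, where D = "{0..}" and C = C and y = y and z = z and t = t])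
    fix C t assume "\<And>t. t \<in> {0..} \<Longrightarrow> l1 (y t - z t) \<le> C" "t \<in> {0::real..}"
    then show "l1 (y t - z t) \<le> 1 / (1 - exp (- \<gamma> * \<omega>)) * (\<omega> * (\<mu> + k2) + l * real q) * C"
      using operator_contraction[OF assms(1,2), of C t] assms(3,4) by simp
  qed (use C assms(5) in auto)
qed

section \<open>A fixed point gives a periodic solution\<close>

text \<open>
  Functions that agree off the impulse times have the same forcing there: the delayed
  argument is a switching time, hence not an impulse time.
\<close>
lemma forcing_off_impulses:
  assumes "\<And>t. 0 \<le> t \<Longrightarrow> t \<notin> range \<tau> \<Longrightarrow> x t = y t" "0 \<le> t" "t \<notin> range \<tau>"
  shows "forcing x i t = forcing y i t"
proof -
  have "pc_arg \<theta> t \<notin> range \<tau>" using switch.pc_arg_in_range[OF assms(2)] disjoint by blast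
  then show ?thesis using assms switch.pc_arg_nonneg by (simp add: forcing_def)
qed

lemma forcing_tendsto:
  assumes "(x \<longlongrightarrow> u) F" "\<forall>\<^sub>F s in F. pc_arg \<theta> s = r"
  shows "(forcing x i \<longlongrightarrow> (\<Sum>j\<in>UNIV. b i j * f j (u $ j)) + (\<Sum>j\<in>UNIV. c i j * g j (x r $ j)) + d i) F"
proof (rule Lim_transform_eventually)
  show "((\<lambda>s. (\<Sum>j\<in>UNIV. b i j * f j (x s $ j)) + (\<Sum>j\<in>UNIV. c i j * g j (x r $ j)) + d i)
     \<longlongrightarrow> (\<Sum>j\<in>UNIV. b i j * f j (u $ j)) + (\<Sum>j\<in>UNIV. c i j * g j (x r $ j)) + d i) F"
    by (intro tendsto_intros continuous_on_tendsto_compose[OF continuous_f] assms(1)) auto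
  show "\<forall>\<^sub>F s in F. (\<Sum>j\<in>UNIV. b i j * f j (x s $ j)) + (\<Sum>j\<in>UNIV. c i j * g j (x r $ j)) + d i = forcing x i s"
    using assms(2) by eventually_elim (simp add: forcing_def)
qed

text \<open>The right-continuous version of \<open>y\<close>; the restriction makes it \<open>undefined\<close> at negative times.\<close>
definition solution_of :: "(real \<Rightarrow> real ^ 'm) \<Rightarrow> real \<Rightarrow> real ^ 'm" where
  "solution_of y = restrict (\<lambda>t. \<chi> i. y t $ i + jump_at (kick y i) t) {0..}"

lemma solution_of_off_impulses: "0 \<le> t \<Longrightarrow> t \<notin> range \<tau> \<Longrightarrow> solution_of y t = y t"
  by (simp add: solution_of_def jump_at_other vec_eq_iff)

text \<open>
  Near \<open>t\<close> the step function in the response is constant on each side, so on each side the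
  solution coincides with a jump-free \<open>flow\<close>. On the right this includes \<open>t\<close> itself, while on
  the left the flow reaches \<open>y t\<close> at \<open>t\<close>. All regularity of the solution follows from this.
\<close>
lemma solution_of_local_flow:
  assumes y: "y \<in> admissible" and fixed: "\<And>t. 0 \<le> t \<Longrightarrow> periodic_operator y t = y t" and "0 \<le> t"
  shows "loc_integrable (\<lambda>s. exp (a i * s) * forcing (solution_of y) i s)"
    and "\<exists>K e. 0 < e \<and> (\<forall>s. t \<le> s \<and> s < t + e \<longrightarrow> solution_of y s $ i = flow (a i) (forcing (solution_of y) i) K s)"
    and "\<exists>K e. 0 < e \<and> y t $ i = flow (a i) (forcing (solution_of y) i) K t \<and>
           (\<forall>s. 0 \<le> s \<and> t - e < s \<and> s < t \<longrightarrow> solution_of y s $ i = flow (a i) (forcing (solution_of y) i) K s)"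
proof -
  let ?h = "forcing (solution_of y) i" and ?w = "weighted (a i) (kick y i)"
  have same: "?h s = forcing y i s" if "0 \<le> s" "s \<notin> range \<tau>" for s
    by (rule forcing_off_impulses[OF _ that]) (rule solution_of_off_impulses)
  show "loc_integrable (\<lambda>s. exp (a i * s) * ?h s)"
    unfolding loc_integrable_def
  proof
    fix T
    show "(\<lambda>s. exp (a i * s) * ?h s) integrable_on {0..T}"
      by (rule integrable_spike[OF _ negligible_times])
        (use forcing_integrable[OF y, of "a i" i] same in \<open>auto simp: loc_integrable_def\<close>)
  qed
  have flow_same: "flow (a i) (forcing y i) K s = flow (a i) ?h K s" for K s
    by (rule flow_cong[OF negligible_times]) (simp add: same)
  define K where "K = exp (- a i * \<omega>) / (1 - exp (- a i * \<omega>)) * accum (a i) (forcing y i) (kick y i) \<omega>"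
  have yflow: "y s $ i = flow (a i) ?h (K + jump_sum ?w s) s" if "0 \<le> s" for s
    using arg_cong[OF fixed[OF that], of "\<lambda>v. v $ i"]
    by (simp add: periodic_operator_def response_def K_def flow_same)
  have xflow: "solution_of y s $ i = flow (a i) ?h (K + jump_sum ?w s + jump_at ?w s) s" if "0 \<le> s" for s
  proof -
    have "exp (- (a i * s)) * (exp (a i * s) * j) = j" for j
      by (simp add: mult.assoc[symmetric] flip: exp_add)
    then show ?thesis
      using yflow[OF that] that by (simp add: solution_of_def flow_def jump_at_weighted algebra_simps)
  qed
  obtain e where e: "0 < e"
    "\<And>s w. t < s \<Longrightarrow> s < t + e \<Longrightarrow> s \<notin> range \<tau> \<and> jump_sum w s = jump_sum w t + jump_at w t"
    "\<And>s w. t - e < s \<Longrightarrow> s < t \<Longrightarrow> s \<notin> range \<tau> \<and> jump_sum w s = jump_sum w t"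
    using jump_sum_locally_constant[of t] by metis
  have "solution_of y s $ i = flow (a i) ?h (K + jump_sum ?w t + jump_at ?w t) s" if "t \<le> s" "s < t + e" for s
  proof (cases "s = t")
    case False
    then show ?thesis using xflow[of s] e(2)[of s ?w] that \<open>0 \<le> t\<close> by (simp add: jump_at_other add.assoc)
  qed (use xflow \<open>0 \<le> t\<close> in simp)
  then show "\<exists>K e. 0 < e \<and> (\<forall>s. t \<le> s \<and> s < t + e \<longrightarrow> solution_of y s $ i = flow (a i) ?h K s)"
    using e(1) by blast
  have "solution_of y s $ i = flow (a i) ?h (K + jump_sum ?w t) s" if "0 \<le> s" "t - e < s" "s < t" for s
    using xflow[of s] e(3)[of s ?w] that by (simp add: jump_at_other)
  then show "\<exists>K e. 0 < e \<and> y t $ i = flow (a i) ?h K t \<and>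
      (\<forall>s. 0 \<le> s \<and> t - e < s \<and> s < t \<longrightarrow> solution_of y s $ i = flow (a i) ?h K s)"
    using e(1) yflow[OF \<open>0 \<le> t\<close>] by blast
qed

text \<open>
  The regularity is obtained in turn: continuity of the flow gives the one-sided limits of the
  solution, these give the one-sided limits of the forcing, and where the forcing is continuous
  from the right (or from both sides) the flow has the corresponding derivative.
\<close>
lemma solution_of_is_solution:
  assumes y: "y \<in> admissible" and fixed: "\<And>t. 0 \<le> t \<Longrightarrow> periodic_operator y t = y t"
  shows "is_solution \<theta> \<tau> a b c d f g I (solution_of y)"
proof -
  let ?x = "solution_of y"
  define x' where "x' t = (\<chi> i. - a i * ?x t $ i + forcing ?x i t)" for t
  have int: "loc_integrable (\<lambda>s. exp (a i * s) * forcing ?x i s)" for i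
    by (rule solution_of_local_flow(1)[OF y fixed, of 0]) auto
  have right_flow: "\<exists>K. ?x t $ i = flow (a i) (forcing ?x i) K t \<and>
      (\<forall>\<^sub>F s in at_right t. flow (a i) (forcing ?x i) K s = ?x s $ i)" if t: "0 \<le> t" for t i
  proof -
    obtain K e where e: "0 < e" "\<And>s. t \<le> s \<Longrightarrow> s < t + e \<Longrightarrow> ?x s $ i = flow (a i) (forcing ?x i) K s"
      using solution_of_local_flow(2)[OF y fixed t, of i] by blast
    then have "\<forall>\<^sub>F s in at_right t. flow (a i) (forcing ?x i) K s = ?x s $ i"
      unfolding eventually_at_right_field by (intro exI[of _ "t + e"]) auto
    then show ?thesis using e by auto
  qed
  have left_flow: "\<exists>K. y t $ i = flow (a i) (forcing ?x i) K t \<and>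
      (\<forall>\<^sub>F s in at_left t. flow (a i) (forcing ?x i) K s = ?x s $ i)" if t: "0 < t" for t i
  proof -
    obtain K e where e: "0 < e" "y t $ i = flow (a i) (forcing ?x i) K t"
      "\<And>s. 0 \<le> s \<Longrightarrow> t - e < s \<Longrightarrow> s < t \<Longrightarrow> ?x s $ i = flow (a i) (forcing ?x i) K s"
      using solution_of_local_flow(3)[OF y fixed less_imp_le[OF t], of i] by blast
    then have "\<forall>\<^sub>F s in at_left t. flow (a i) (forcing ?x i) K s = ?x s $ i"
      unfolding eventually_at_left_field using t by (intro exI[of _ "max 0 (t - e)"]) auto
    then show ?thesis using e by auto
  qed
  have flow_right: "(flow (a i) (forcing ?x i) K \<longlongrightarrow> flow (a i) (forcing ?x i) K t) (at_right t)" if "0 \<le> t" for i K t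
    by (rule tendsto_within_subset[where S = "{0..}"])
      (use flow_continuous[OF int, of i K] that in \<open>auto simp: continuous_on_def\<close>)
  have flow_left: "(flow (a i) (forcing ?x i) K \<longlongrightarrow> flow (a i) (forcing ?x i) K t) (at_left t)" if "0 < t" for i K t
  proof -
    have "(flow (a i) (forcing ?x i) K \<longlongrightarrow> flow (a i) (forcing ?x i) K t) (at t within {0..t})"
      by (rule tendsto_within_subset[where S = "{0..}"])
        (use flow_continuous[OF int, of i K] that in \<open>auto simp: continuous_on_def\<close>)
    then show ?thesis using that by (simp add: at_within_Icc_at_left)
  qed
  have x_right: "(?x \<longlongrightarrow> ?x t) (at_right t)" if t: "0 \<le> t" for t
  proof (rule vec_tendstoI)
    fix i
    obtain K where K: "?x t $ i = flow (a i) (forcing ?x i) K t"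
      "\<forall>\<^sub>F s in at_right t. flow (a i) (forcing ?x i) K s = ?x s $ i" using right_flow[OF t] by blast
    show "((\<lambda>s. ?x s $ i) \<longlongrightarrow> ?x t $ i) (at_right t)"
      using Lim_transform_eventually[OF flow_right[OF t] K(2)] K(1) by simp
  qed
  have x_left: "(?x \<longlongrightarrow> y t) (at_left t)" if t: "0 < t" for t
  proof (rule vec_tendstoI)
    fix i
    obtain K where K: "y t $ i = flow (a i) (forcing ?x i) K t"
      "\<forall>\<^sub>F s in at_left t. flow (a i) (forcing ?x i) K s = ?x s $ i" using left_flow[OF t] by blast
    show "((\<lambda>s. ?x s $ i) \<longlongrightarrow> y t $ i) (at_left t)"
      using Lim_transform_eventually[OF flow_left[OF t] K(2)] K(1) by simp
  qed
  have x_cont: "isCont ?x t" if "0 < t" "t \<notin> range \<tau>" for t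
    using x_left[of t] x_right[of t] that by (simp add: isCont_left_right solution_of_off_impulses)
  have h_right: "(forcing ?x i \<longlongrightarrow> forcing ?x i t) (at_right t)" if "0 \<le> t" for i t
    using forcing_tendsto[OF x_right[OF that] switch.pc_arg_right[OF that]] by (simp add: forcing_def)
  have h_left: "\<exists>v. (forcing ?x i \<longlongrightarrow> v) (at_left t)" if "0 < t" for i t
    using forcing_tendsto[OF x_left[OF that]] switch.pc_arg_left[OF that] by blast
  have h_cont: "isCont (forcing ?x i) t" if t: "0 < t" "t \<notin> range \<tau> \<union> range \<theta>" for i t
  proof -
    have "(?x \<longlongrightarrow> ?x t) (at_left t)" using x_cont[of t] t by (simp add: isCont_left_right)
    moreover have "\<forall>\<^sub>F s in at_left t. pc_arg \<theta> s = pc_arg \<theta> t" using switch.pc_arg_left[OF t(1)] t by auto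
    ultimately have "(forcing ?x i \<longlongrightarrow> forcing ?x i t) (at_left t)"
      using forcing_tendsto unfolding forcing_def by blast
    then show ?thesis using h_right[of t i] t by (simp add: isCont_left_right)
  qed
  have "right_cont_except (range \<tau>) ?x"
    using x_right x_left x_cont by (auto simp: right_cont_except_def continuous_within)
  moreover have "right_cont_except (range \<tau> \<union> range \<theta>) x'"
    unfolding right_cont_except_def
  proof (intro conjI allI impI)
    fix t :: real assume t: "0 \<le> t"
    show "continuous (at_right t) x'"
      unfolding continuous_within x'_def
      by (intro tendsto_vec_lambda tendsto_intros x_right h_right t)
  next
    fix t :: real assume t: "0 < t" "t \<notin> range \<tau> \<union> range \<theta>"
    have "isCont ?x t" using x_cont t by simp
    then show "isCont x' t"
      unfolding isCont_def x'_def
      by (intro tendsto_vec_lambda tendsto_intros h_cont[unfolded isCont_def] t) (auto intro: tendsto_intros)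
  next
    fix t :: real assume t: "0 < t" "t \<in> range \<tau> \<union> range \<theta>"
    obtain v where v: "\<And>i. (forcing ?x i \<longlongrightarrow> v i) (at_left t)" using h_left[OF t(1)] by metis
    have "(x' \<longlongrightarrow> (\<chi> i. - a i * y t $ i + v i)) (at_left t)"
      unfolding x'_def by (intro tendsto_vec_lambda tendsto_intros x_left v t)
    then show "\<exists>u. (x' \<longlongrightarrow> u) (at_left t)" by blast
  qed
  moreover have "(?x has_vector_derivative x' t) (at_right t)" if t: "0 \<le> t" for t
  proof (rule has_vector_derivative_vecI)
    fix i
    obtain K where K: "?x t $ i = flow (a i) (forcing ?x i) K t"
      "\<forall>\<^sub>F s in at_right t. flow (a i) (forcing ?x i) K s = ?x s $ i" using right_flow[OF t] by blast
    have "continuous (at_right t) (forcing ?x i)" using h_right[OF t] by (simp add: continuous_within)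
    from has_vector_derivative_transform_eventually[OF flow_right_derivative[OF int t this] K(2)] K(1)
    show "((\<lambda>s. ?x s $ i) has_vector_derivative x' t $ i) (at_right t)" by (simp add: x'_def)
  qed
  moreover have "(?x has_vector_derivative x' t) (at t)" if t: "0 < t" "t \<notin> range \<tau> \<union> range \<theta>" for t
  proof (rule has_vector_derivative_vecI)
    fix i
    obtain K where K: "?x t $ i = flow (a i) (forcing ?x i) K t"
      "\<forall>\<^sub>F s in at_right t. flow (a i) (forcing ?x i) K s = ?x s $ i" using right_flow[of t i] t by auto
    obtain L where L: "y t $ i = flow (a i) (forcing ?x i) L t"
      "\<forall>\<^sub>F s in at_left t. flow (a i) (forcing ?x i) L s = ?x s $ i" using left_flow[OF t(1)] by blast
    \<comment> \<open>Away from impulse times the flows on the two sides have the same value at \<open>t\<close>, so they coincide.\<close>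
    have "?x t = y t" using t by (simp add: solution_of_off_impulses)
    then have "K = L" using K(1) L(1) by (simp add: flow_def)
    then have "\<forall>\<^sub>F s in at t. flow (a i) (forcing ?x i) K s = ?x s $ i"
      using K(2) L(2) by (simp add: eventually_at_split)
    from has_vector_derivative_transform_eventually[OF flow_derivative[OF int t(1) h_cont[OF t]] this] K(1)
    show "((\<lambda>s. ?x s $ i) has_vector_derivative x' t $ i) (at t)" by (simp add: x'_def)
  qed
  moreover have "x' t $ i = - a i * ?x t $ i + (\<Sum>j\<in>UNIV. b i j * f j (?x t $ j))
      + (\<Sum>j\<in>UNIV. c i j * g j (?x (pc_arg \<theta> t) $ j)) + d i" for t i
    by (simp add: x'_def forcing_def)
  moreover have "?x (\<tau> k) $ i - left_lim ?x (\<tau> k) $ i = I i k (left_lim ?x (\<tau> k) $ i)" if k: "0 < \<tau> k" for k i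
  proof -
    have "left_lim ?x (\<tau> k) = y (\<tau> k)"
      unfolding left_lim_def using x_left[OF k] by (intro tendsto_Lim) auto
    then show ?thesis using k jump_at_impulse[OF k] by (simp add: solution_of_def kick_def)
  qed
  ultimately show ?thesis
    unfolding is_solution_def by (intro conjI exI[of _ x']) (auto simp: solution_of_def)
qed

lemma solution_of_periodic:
  assumes "y \<in> admissible"
  shows "is_periodic \<omega> (solution_of y)"
proof -
  have per: "\<And>t. 0 \<le> t \<Longrightarrow> y (t + \<omega>) = y t" using assms by (simp add: admissible_def)
  have "jump_at (kick y i) (t + \<omega>) = jump_at (kick y i) t" if "0 \<le> t" for i t
    by (rule jump_at_shift) (auto intro: kick_periodic per that)
  then show ?thesis using per period_pos by (simp add: is_periodic_def solution_of_def)
qed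

section \<open>A periodic solution gives a fixed point\<close>

definition left_version :: "(real \<Rightarrow> real ^ 'm) \<Rightarrow> real \<Rightarrow> real ^ 'm" where
  "left_version x t = (if t \<in> range \<tau> \<and> 0 < t then left_lim x t else x t)"

lemma left_version_tendsto:
  assumes "right_cont_except (range \<tau>) x" "0 < t"
  shows "(x \<longlongrightarrow> left_version x t) (at_left t)"
proof (cases "t \<in> range \<tau>")
  case True
  then obtain u where u: "(x \<longlongrightarrow> u) (at_left t)" using assms by (auto simp: right_cont_except_def)
  then have "left_lim x t = u" unfolding left_lim_def by (intro tendsto_Lim) auto
  with u show ?thesis using True assms(2) by (simp add: left_version_def)
next
  case False
  then have "isCont x t" using assms by (simp add: right_cont_except_def)
  then show ?thesis using False by (simp add: left_version_def isCont_left_right)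
qed

lemma solution_jump:
  assumes "is_solution \<theta> \<tau> a b c d f g I x" "0 \<le> t"
  shows "x t $ i = left_version x t $ i + jump_at (kick (left_version x) i) t"
proof (cases "t \<in> range \<tau> \<and> 0 < t")
  case True
  then obtain k where k: "t = \<tau> k" "0 < \<tau> k" by auto
  then have "x t $ i - left_lim x t $ i = I i k (left_lim x t $ i)"
    using assms(1) by (simp add: is_solution_def)
  then show ?thesis using k jump_at_impulse[OF k(2)] by (simp add: left_version_def kick_def)
next
  case False
  moreover have "0 \<notin> range \<tau>" by (rule no_impulse_0)
  ultimately have "t \<notin> range \<tau>" using assms(2) by (cases "t = 0") auto
  then show ?thesis by (simp add: left_version_def jump_at_other)
qed

text \<open>
  The function \<open>exp (a * t) * x t\<close> minus the weighted jumps up to and including \<open>t\<close> is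
  continuous, since the jumps cancel, and its derivative is \<open>exp (a * t)\<close> times the forcing except
  at finitely many points of each bounded interval. The fundamental theorem of calculus then
  gives the formula, and with it the integrability of the forcing.
\<close>
lemma solution_variation_of_constants:
  assumes sol: "is_solution \<theta> \<tau> a b c d f g I x"
  shows "loc_integrable (\<lambda>s. exp (a i * s) * forcing x i s)"
    and "0 \<le> t \<Longrightarrow> left_version x t $ i =
      flow (a i) (forcing x i) (x 0 $ i + jump_sum (weighted (a i) (kick (left_version x) i)) t) t"
proof -
  let ?y = "left_version x"
  let ?w = "weighted (a i) (kick ?y i)" and ?k = "\<lambda>s. exp (a i * s) * forcing x i s"
  have rce: "right_cont_except (range \<tau>) x" using sol by (simp add: is_solution_def)
  obtain x' where x': "\<And>t. 0 < t \<Longrightarrow> t \<notin> range \<tau> \<union> range \<theta> \<Longrightarrow> (x has_vector_derivative x' t) (at t)"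
    and ode: "\<And>t i. 0 \<le> t \<Longrightarrow> t \<notin> range \<tau> \<Longrightarrow> x' t $ i = - a i * x t $ i + forcing x i t"
    using sol unfolding is_solution_def forcing_def by (force simp: add.assoc)
  define E where "E s = exp (a i * s) * x s $ i - (jump_sum ?w s + jump_at ?w s)" for s
  \<comment> \<open>In terms of the left-continuous version only the jumps strictly before \<open>t\<close> are subtracted.\<close>
  have E_left_value: "E t = exp (a i * t) * ?y t $ i - jump_sum ?w t" if "0 \<le> t" for t
    using solution_jump[OF sol that, of i] by (simp add: E_def jump_at_weighted algebra_simps)
  have E_right: "(E \<longlongrightarrow> E t) (at_right t)" if t: "0 \<le> t" for t
  proof (rule Lim_transform_eventually)
    obtain e where "0 < e"
      "\<And>s w. t < s \<Longrightarrow> s < t + e \<Longrightarrow> s \<notin> range \<tau> \<and> jump_sum w s = jump_sum w t + jump_at w t"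
      using jump_sum_locally_constant[of t] by metis
    then show "\<forall>\<^sub>F s in at_right t. exp (a i * s) * x s $ i - (jump_sum ?w t + jump_at ?w t) = E s"
      unfolding eventually_at_right_field by (intro exI[of _ "t + e"]) (simp add: E_def jump_at_other)
    have "(x \<longlongrightarrow> x t) (at_right t)" using rce t by (simp add: right_cont_except_def continuous_within)
    then show "((\<lambda>s. exp (a i * s) * x s $ i - (jump_sum ?w t + jump_at ?w t)) \<longlongrightarrow> E t) (at_right t)"
      unfolding E_def by (intro tendsto_intros)
  qed
  have E_left: "(E \<longlongrightarrow> E t) (at_left t)" if t: "0 < t" for t
  proof (rule Lim_transform_eventually)
    obtain e where "0 < e"
      "\<And>s w. t - e < s \<Longrightarrow> s < t \<Longrightarrow> s \<notin> range \<tau> \<and> jump_sum w s = jump_sum w t"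
      using jump_sum_locally_constant[of t] by metis
    then show "\<forall>\<^sub>F s in at_left t. exp (a i * s) * x s $ i - jump_sum ?w t = E s"
      unfolding eventually_at_left_field by (intro exI[of _ "t - e"]) (simp add: E_def jump_at_other)
    show "((\<lambda>s. exp (a i * s) * x s $ i - jump_sum ?w t) \<longlongrightarrow> E t) (at_left t)"
      unfolding E_left_value[OF less_imp_le[OF t]] by (intro tendsto_intros left_version_tendsto rce t)
  qed
  have E_deriv: "(E has_vector_derivative ?k t) (at t)" if t: "0 < t" "t \<notin> range \<tau> \<union> range \<theta>" for t
  proof (rule has_vector_derivative_transform_eventually)
    let ?G = "\<lambda>s. exp (a i * s) * x s $ i - jump_sum ?w t"
    have "((\<lambda>s. x s $ i) has_real_derivative - a i * x t $ i + forcing x i t) (at t)"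
      using has_vector_derivative_vecD[OF x'[OF t], of i] ode[of t i] t
      by (simp add: has_real_derivative_iff_has_vector_derivative)
    then have "(?G has_real_derivative ?k t) (at t)"
      by (auto intro!: derivative_eq_intros simp: algebra_simps)
    then show "(?G has_vector_derivative ?k t) (at t)"
      by (simp add: has_real_derivative_iff_has_vector_derivative)
    obtain e where e: "0 < e"
      "\<And>s w. t < s \<Longrightarrow> s < t + e \<Longrightarrow> s \<notin> range \<tau> \<and> jump_sum w s = jump_sum w t + jump_at w t"
      "\<And>s w. t - e < s \<Longrightarrow> s < t \<Longrightarrow> s \<notin> range \<tau> \<and> jump_sum w s = jump_sum w t"
      using jump_sum_locally_constant[of t] by metis
    have t0: "jump_at ?w t = 0" using t by (simp add: jump_at_other)
    then show "?G t = E t" by (simp add: E_def)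
    show "\<forall>\<^sub>F s in at t. ?G s = E s"
      unfolding eventually_at
    proof (intro exI[of _ e] conjI ballI impI)
      fix s assume "s \<noteq> t \<and> dist s t < e"
      then consider "t < s" "s < t + e" | "t - e < s" "s < t" by (auto simp: dist_real_def abs_if split: if_splits)
      then show "?G s = E s" using e(2)[of s ?w] e(3)[of s ?w] t0 by cases (auto simp: E_def jump_at_other)
    qed (rule e(1))
  qed
  have E0: "E 0 = x 0 $ i"
  proof -
    have "jump_sum ?w 0 = 0" unfolding jump_sum_def by (rule sum.neutral) auto
    then show ?thesis using no_impulse_0 by (simp add: E_def jump_at_other)
  qed
  have FTC: "(?k has_integral (E T - E 0)) {0..T}" if T: "0 < T" for T
  proof (rule fundamental_theorem_of_calculus_interior_strong[where S = "(range \<tau> \<union> range \<theta>) \<inter> {..T}"])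
    have "(range \<tau> \<union> range \<theta>) \<inter> {..T} = \<tau> ` {k. \<tau> k \<le> T} \<union> \<theta> ` {k. \<theta> k \<le> T}" by auto
    then show "finite ((range \<tau> \<union> range \<theta>) \<inter> {..T})"
      by (simp add: finite_up_to switch.finite_up_to)
    show "continuous_on {0..T} E"
      by (rule continuous_on_IccI)
        (use E_left E_right T in \<open>auto simp: filterlim_at_split\<close>)
  qed (use T E_deriv in auto)
  show "loc_integrable ?k"
    unfolding loc_integrable_def
  proof
    fix T :: real
    show "?k integrable_on {0..T}"
    proof (cases "0 < T")
      case True
      then show ?thesis using FTC by blast
    next
      case False
      then have "negligible {0..T}" by (cases "T = 0") auto
      then show ?thesis by (rule integrable_negligible)
    qed
  qed
  assume t: "0 \<le> t"
  have "E t = x 0 $ i + integral {0..t} ?k"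
  proof (cases "t = 0")
    case False
    then show ?thesis using integral_unique[OF FTC[of t]] E0 t by simp
  qed (simp add: E0)
  then have "exp (a i * t) * ?y t $ i = x 0 $ i + jump_sum ?w t + integral {0..t} ?k"
    using E_left_value[OF t] by simp
  moreover have "?y t $ i = exp (- a i * t) * (exp (a i * t) * ?y t $ i)"
    by (simp add: mult.assoc[symmetric] flip: exp_add)
  ultimately show "?y t $ i = flow (a i) (forcing x i) (x 0 $ i + jump_sum ?w t) t"
    by (simp add: flow_def)
qed

text \<open>
  The left limits of \<open>x\<close> at \<open>t\<close> and at \<open>t + \<omega>\<close> agree because the values of \<open>x\<close> to the left of
  these points do.
\<close>
lemma left_version_periodic:
  assumes "right_cont_except (range \<tau>) x" "is_periodic \<omega> x" "0 \<le> t"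
  shows "left_version x (t + \<omega>) = left_version x t"
proof (cases "t = 0")
  case True
  then show ?thesis
    using assms(2) no_impulse_0 no_impulse_period
    by (auto simp: left_version_def is_periodic_def dest: spec[of _ 0])
next
  case False
  then have t: "0 < t" using assms(3) by simp
  have "filterlim (\<lambda>s. s + \<omega>) (at_left (t + \<omega>)) (at_left t)"
  proof (rule filterlim_at_withinI)
    show "((\<lambda>s. s + \<omega>) \<longlongrightarrow> t + \<omega>) (at_left t)" by (intro tendsto_intros)
    show "\<forall>\<^sub>F s in at_left t. s + \<omega> \<in> {..<t + \<omega>} - {t + \<omega>}"
      by (auto simp: eventually_at_left_field intro: exI[of _ "t - 1"])
  qed
  from filterlim_compose[OF left_version_tendsto this]
  have "((\<lambda>s. x (s + \<omega>)) \<longlongrightarrow> left_version x (t + \<omega>)) (at_left t)"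
    using assms(1) t period_pos by simp
  moreover have "\<forall>\<^sub>F s in at_left t. x (s + \<omega>) = x s"
    using assms(2) t by (auto simp: is_periodic_def eventually_at_left_field intro: exI[of _ 0])
  ultimately have "(x \<longlongrightarrow> left_version x (t + \<omega>)) (at_left t)"
    by (rule Lim_transform_eventually)
  then show ?thesis
    using left_version_tendsto[OF assms(1) t] tendsto_unique[of "at_left t"] by auto
qed

lemma left_version_fixed_point:
  assumes sol: "is_solution \<theta> \<tau> a b c d f g I x" and per: "is_periodic \<omega> x"
  shows "left_version x \<in> admissible"
    and "0 \<le> t \<Longrightarrow> periodic_operator (left_version x) t = left_version x t"
proof -
  let ?y = "left_version x"
  have rce: "right_cont_except (range \<tau>) x" using sol by (simp add: is_solution_def)
  note formula = solution_variation_of_constants(2)[OF sol]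
    and int = solution_variation_of_constants(1)[OF sol]
  show "?y \<in> admissible"
  proof (rule admissibleI)
    fix i
    let ?F = "\<lambda>t. flow (a i) (forcing x i) (x 0 $ i + jump_sum (weighted (a i) (kick ?y i)) t) t"
    have "?F \<in> borel_measurable (restrict_space borel {0..})"
      by (rule flow_jump_measurable[OF int])
    then show "(\<lambda>t. ?y t $ i) \<in> borel_measurable (restrict_space borel {0..})"
      by (rule measurable_cong[THEN iffD1, rotated]) (simp add: space_restrict_space formula)
    show "\<exists>B. \<forall>t\<in>{0..\<omega>}. \<bar>?y t $ i\<bar> \<le> B"
      using flow_jump_bounded[OF int, of i "x 0 $ i" "weighted (a i) (kick ?y i)"] by (simp add: formula)
  qed (rule left_version_periodic[OF rce per])
  have same: "flow (a i) (forcing x i) K s = flow (a i) (forcing ?y i) K s" for i K s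
    by (rule flow_cong[OF negligible_times], rule forcing_off_impulses) (auto simp: left_version_def)
  assume t: "0 \<le> t"
  have "response (a i) (forcing ?y i) (kick ?y i) t = ?y t $ i" for i
  proof -
    have "?y \<omega> = x 0"
      using per no_impulse_period by (auto simp: left_version_def is_periodic_def dest: spec[of _ 0])
    then have "x 0 $ i = exp (- a i * \<omega>) / (1 - exp (- a i * \<omega>)) * accum (a i) (forcing ?y i) (kick ?y i) \<omega>"
      using formula[of \<omega> i] period_pos by (intro response_unique[OF a_pos]) (simp add: same)
    then show ?thesis using formula[OF t, of i] by (simp add: response_def same)
  qed
  then show "periodic_operator ?y t = ?y t" by (simp add: periodic_operator_def)
qed

text \<open>
  For uniqueness, the left-continuous versions of two periodic solutions are fixed points and
  hence agree; a solution is recovered from its left-continuous version by the jump condition.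
\<close>
theorem unique_periodic_solution:
  "\<exists>!x. is_solution \<theta> \<tau> a b c d f g I x \<and> is_periodic \<omega> x"
proof (rule ex_ex1I)
  obtain y where "y \<in> admissible" "\<And>t. 0 \<le> t \<Longrightarrow> periodic_operator y t = y t"
    using fixed_point_exists by blast
  then show "\<exists>x. is_solution \<theta> \<tau> a b c d f g I x \<and> is_periodic \<omega> x"
    using solution_of_is_solution solution_of_periodic by blast
next
  fix x z
  assume x: "is_solution \<theta> \<tau> a b c d f g I x \<and> is_periodic \<omega> x"
    and z: "is_solution \<theta> \<tau> a b c d f g I z \<and> is_periodic \<omega> z"
  have left: "left_version x t = left_version z t" if "0 \<le> t" for t
    by (rule fixed_point_unique) (use x z that left_version_fixed_point in auto)
  have kick: "jump_at (kick (left_version x) i) t = jump_at (kick (left_version z) i) t" for i t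
    unfolding jump_at_def kick_def by (rule sum.cong) (auto simp: left)
  have "x t = z t" if "0 \<le> t" for t
    using solution_jump[of x t] solution_jump[of z t] x z that by (simp add: vec_eq_iff left kick)
  moreover have "x \<in> extensional {0..}" "z \<in> extensional {0..}"
    using x z by (auto simp: is_solution_def)
  ultimately show "x = z" by (intro extensionalityI[of x "{0..}" z]) auto
qed

end

text \<open>
  Write \<open>A = (1 + l) ^ p * exp (k1 * h)\<close>, \<open>u = (k1 * h + l * p) * A\<close> and \<open>v = k2 * h\<close>. The
  hypothesis says \<open>u + 2 * v * A < 1\<close>, and since \<open>A \<ge> 1\<close> and \<open>u \<le> 1\<close>, the number subtracted
  from \<open>1\<close> is \<open>v + u * (1 + v) \<le> u + 2 * v < 1\<close>.
\<close>
lemma memory_factor_ge_1: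
  fixes k1 k2 h l :: real
  assumes "0 \<le> k1" "0 \<le> k2" "0 \<le> h" "0 \<le> l"
    and small: "((k1 + 2 * k2) * h + l * real p) * (1 + l) ^ p * exp (k1 * h) < 1"
  shows "1 \<le> inverse (1 - (k2 * h + (k1 * h + l * real p) * (1 + k2 * h) * (1 + l) ^ p * exp (k1 * h)))"
proof -
  define A where "A = (1 + l) ^ p * exp (k1 * h)"
  define u where "u = (k1 * h + l * real p) * A"
  define v where "v = k2 * h"
  have A: "1 \<le> A"
    unfolding A_def using assms mult_mono[of 1 "(1 + l) ^ p" 1 "exp (k1 * h)"] by simp
  have v: "0 \<le> v" using assms by (simp add: v_def)
  have u: "0 \<le> u" using assms A by (simp add: u_def)
  have "u + 2 * (v * A) < 1"
    using small by (simp add: u_def v_def A_def algebra_simps)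
  moreover have "v \<le> v * A" using A v mult_left_mono[of 1 A v] by simp
  ultimately have sum: "u + 2 * v < 1" by linarith
  then have "u * v \<le> 1 * v" using u v by (intro mult_right_mono) auto
  then have "v + u * (1 + v) < 1" using sum by (simp add: algebra_simps)
  moreover have "0 \<le> v + u * (1 + v)" using u v by simp
  ultimately have "1 \<le> inverse (1 - (v + u * (1 + v)))" by (intro one_le_inverse) auto
  then show ?thesis by (simp add: u_def v_def A_def ac_simps)
qed

theorem theorem4p1:
  fixes \<theta> \<tau> :: "nat \<Rightarrow> real" and \<theta>bar \<tau>low \<omega> l :: real and p q p1 :: nat
    and a d Lf Lg :: "'m::finite \<Rightarrow> real" and b c :: "'m \<Rightarrow> 'm \<Rightarrow> real"
    and f g :: "'m \<Rightarrow> real \<Rightarrow> real" and I :: "'m \<Rightarrow> nat \<Rightarrow> real \<Rightarrow> real"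
    and k1 k2 \<mu> \<gamma> lam R :: real
  assumes theta: "\<theta> 0 = 0" "strict_mono \<theta>" "filterlim \<theta> at_top sequentially"
    and tau: "strict_mono \<tau>" "filterlim \<tau> at_top sequentially"
    and disjoint: "range \<tau> \<inter> range \<theta> = {}"
    and theta_gap: "\<theta>bar > 0" "\<And>k. \<theta> (Suc k) - \<theta> k \<le> \<theta>bar"
    and tau_gap: "\<tau>low > 0" "\<And>k. \<tau>low \<le> \<tau> (Suc k) - \<tau> k"
    and p: "finite (range (impulse_count \<theta> \<tau>))" "p = Max (range (impulse_count \<theta> \<tau>))"
    and a_pos: "\<And>i. a i > 0"
    and k1: "k1 = (MAX i. a i + Lf i * (\<Sum>j\<in>UNIV. \<bar>b j i\<bar>))"
    and k2: "k2 = (MAX i. Lg i * (\<Sum>j\<in>UNIV. \<bar>c j i\<bar>))"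
    and mu: "\<mu> = (MAX i. Lf i * (\<Sum>j\<in>UNIV. \<bar>b j i\<bar>))"
    and gamma: "\<gamma> = (MIN i. a i)"
    and lam: "lam = inverse (1 - (k2 * \<theta>bar
                 + (k1 * \<theta>bar + l * real p) * (1 + k2 * \<theta>bar) * (1 + l) ^ p * exp (k1 * \<theta>bar)))"
    and f_lipschitz: "\<And>j. Lf j > 0" "\<And>j u v. \<bar>f j u - f j v\<bar> \<le> Lf j * \<bar>u - v\<bar>"
    and g_lipschitz: "\<And>j. Lg j > 0" "\<And>j u v. \<bar>g j u - g j v\<bar> \<le> Lg j * \<bar>u - v\<bar>"
    and I_lipschitz: "l > 0" "\<And>i k u v. \<bar>I i k u - I i k v\<bar> \<le> l * \<bar>u - v\<bar>"
    and small: "((k1 + 2 * k2) * \<theta>bar + l * real p) * (1 + l) ^ p * exp (k1 * \<theta>bar) < 1"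
    and periods: "\<omega> > 0" "q > 0" "p1 > 0"
    and tau_periodic: "\<And>k. \<tau> (k + q) = \<tau> k + \<omega>"
    and theta_periodic: "\<And>k. \<theta> (k + p1) = \<theta> k + \<omega>"
    and I_periodic: "\<And>i k. I i (k + q) = I i k"
    and tau_count: "card (range \<tau> \<inter> {0..\<omega>}) = q"
    and R: "R = 1 / (1 - exp (- \<gamma> * \<omega>))"
    and contraction: "R * (\<omega> * (\<mu> + lam * k2) + l * real q) < 1"
  shows "\<exists>!x :: real \<Rightarrow> real ^ 'm. is_solution \<theta> \<tau> a b c d f g I x \<and> is_periodic \<omega> x"
proof -
  have Max_ge': "h i \<le> (MAX i. h i)" for h :: "'m \<Rightarrow> real" and i by (rule Max_ge) auto
  have mu_ge: "Lf i * (\<Sum>j\<in>UNIV. \<bar>b j i\<bar>) \<le> \<mu>" for i unfolding mu by (rule Max_ge')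
  have k2_ge: "Lg i * (\<Sum>j\<in>UNIV. \<bar>c j i\<bar>) \<le> k2" for i unfolding k2 by (rule Max_ge')
  have gamma_le: "\<gamma> \<le> a i" for i unfolding gamma by (rule Min_le) auto
  have gamma_pos: "0 < \<gamma>" unfolding gamma by (subst Min_gr_iff) (auto simp: a_pos)
  have k2_nonneg: "0 \<le> k2"
    using g_lipschitz(1)[of undefined]
    by (intro order_trans[OF _ k2_ge[of undefined]] mult_nonneg_nonneg sum_nonneg) auto
  have "a i + Lf i * (\<Sum>j\<in>UNIV. \<bar>b j i\<bar>) \<le> k1" for i unfolding k1 by (rule Max_ge')
  moreover have "0 \<le> a i + Lf i * (\<Sum>j\<in>UNIV. \<bar>b j i\<bar>)" for i
    using a_pos[of i] f_lipschitz(1)[of i] by (intro add_nonneg_nonneg mult_nonneg_nonneg sum_nonneg) auto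
  ultimately have "0 \<le> k1" using order_trans by blast
  then have lam_ge: "1 \<le> lam"
    unfolding lam using k2_nonneg theta_gap(1) I_lipschitz(1) small by (intro memory_factor_ge_1) auto
  have R_pos: "0 < R"
    unfolding R using gamma_pos periods(1) by simp
  have "R * (\<omega> * (\<mu> + k2) + l * real q) \<le> R * (\<omega> * (\<mu> + lam * k2) + l * real q)"
    using R_pos periods(1) mult_right_mono[OF lam_ge k2_nonneg] I_lipschitz(1)
    by (intro mult_left_mono add_mono) auto
  then have factor: "R * (\<omega> * (\<mu> + k2) + l * real q) < 1" using contraction by linarith
  \<comment> \<open>Both ends of the first period are switching times and therefore not impulse times.\<close>
  have switch_0: "0 \<in> range \<theta>" "\<omega> \<in> range \<theta>"
    using theta(1) theta_periodic[of 0] rangeI[of \<theta> 0] rangeI[of \<theta> "0 + p1"] by auto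
  interpret impulsive_network \<tau> \<theta> \<omega> q p1 a d Lf Lg b c f g I l \<mu> k2 \<gamma>
  proof unfold_locales
    show "0 \<notin> range \<tau>" "\<omega> \<notin> range \<tau>" using disjoint switch_0 by blast+
    show "1 / (1 - exp (- \<gamma> * \<omega>)) * (\<omega> * (\<mu> + k2) + l * real q) < 1" using factor by (simp add: R)
  qed (use assms mu_ge k2_ge gamma_le gamma_pos in \<open>auto intro: less_imp_le\<close>)
  show ?thesis by (rule unique_periodic_solution)
qed

end
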